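(* Let $A$ be a scalar type spectral operator in a complex Banach space $(X,\|\cdot\|)$. Every weak solution of the evolution equation $y'(t)=Ay(t)$, $t\ge0$, is an entire vector function if and only if there is a $b_+>0$ such that the set $\sigma(A)\setminus\mathscr{P}^{1}_{b_+}$ is bounded, where $$\mathscr{P}^{1}_{b_+}:=\left\{\lambda\in\mathbb{C}\,\middle|\,\operatorname{Re}\lambda\ge b_+|\operatorname{Im}\lambda|\right\}$$ and $\sigma(A)$ is the spectrum of $A$.
   Context: **Scalar type spectral operator (in the sense of Dunford).** A closed densely defined linear operator $A$ (possibly unbounded) in a complex Banach space $X$ for which there is a strongly $\sigma$-additive spectral measure $E_A(\cdot)$ (resolution of the identity) assigning to each Borel set $\delta\subseteq\mathbb{C}$ a bounded projection operator $E_A(\delta)$ on $X$, with $E_A(\emptyset)=0$, $E_A(\mathbb{C})=I$, $E_A(\delta)E_A(\sigma)=E_A(\delta\cap\sigma)$, having the spectrum $\sigma(A)$ as its support, and such that $A=\int_{\sigma(A)}\lambda\,dE_A(\lambda)$, i.e., $Af=\lim_{n\to\infty}\int_{\{\lambda\in\sigma(A):|\lambda|\le n\}}\lambda\,dE_A(\lambda)f$ with $D(A)$ being the set of all $f\in X$ for which this limit exists. $A$ is not assumed to generate a $C_0$-semigroup. **Weak solution.** A strongly continuous function $y:[0,\infty)\to X$ is a weak solution of $y'(t)=Ay(t)$, $t\ge0$, if for every $g^*\in D(A^* )$, $$\frac{d}{dt}\langle y(t),g^*\rangle=\langle y(t),A^*g^*\rangle,\quad t\ge 0,$$ where $A^*$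 is the adjoint of $A$ and $\langle\cdot,\cdot\rangle$ is the pairing between $X$ and its dual $X^*$. Equivalently, for all $t\ge0$, $\int_0^t y(s)\,ds\in D(A)$ and $y(t)=y(0)+A\int_0^t y(s)\,ds$. **Entire vector function.** A function $y:[0,\infty)\to X$ is called entire if it allows an entire continuation, i.e., it is the restriction to $[0,\infty)$ of an entire (analytic on all of $\mathbb{C}$) $X$-valued function. *)

theory Defs
  imports "HOL-Analysis.Analysis"
begin

section \<open>Complex Banach spaces\<close>

class complex_banach = banach +
  fixes scaleC :: "complex \<Rightarrow> 'a \<Rightarrow> 'a"  (infixr "*\<^sub>C" 75)
  assumes scaleC_add_right: "c *\<^sub>C (x + y) = c *\<^sub>C x + c *\<^sub>C y"
    and scaleC_add_left: "(c + d) *\<^sub>C x = c *\<^sub>C x + d *\<^sub>C x"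
    and scaleC_scaleC: "c *\<^sub>C (d *\<^sub>C x) = (c * d) *\<^sub>C x"
    and scaleC_of_real: "complex_of_real r *\<^sub>C x = r *\<^sub>R x"
    and norm_scaleC: "norm (c *\<^sub>C x) = cmod c * norm x"

instantiation complex :: complex_banach
begin

definition scaleC_complex :: "complex \<Rightarrow> complex \<Rightarrow> complex" where
  "scaleC_complex c x = c * x"

instance
  by standard (simp_all add: scaleC_complex_def algebra_simps norm_mult scaleR_conv_of_real)

end

definition bounded_clinear :: "('a::complex_banach \<Rightarrow> 'b::complex_banach) \<Rightarrow> bool" where
  "bounded_clinear f \<longleftrightarrow> bounded_linear f \<and> (\<forall>c x. f (c *\<^sub>C x) = c *\<^sub>C f x)"

section \<open>Unbounded operators\<close>

text \<open>An unbounded operator is given by its domain \<open>D\<close> and a total function \<open>A\<close>, of which only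
  the values on \<open>D\<close> are ever used.\<close>

definition linear_operator :: "'a::complex_banach set \<Rightarrow> ('a \<Rightarrow> 'a) \<Rightarrow> bool" where
  "linear_operator D A \<longleftrightarrow>
     0 \<in> D \<and>
     (\<forall>x\<in>D. \<forall>y\<in>D. x + y \<in> D \<and> A (x + y) = A x + A y) \<and>
     (\<forall>c. \<forall>x\<in>D. c *\<^sub>C x \<in> D \<and> A (c *\<^sub>C x) = c *\<^sub>C A x)"

definition closed_operator :: "'a::complex_banach set \<Rightarrow> ('a \<Rightarrow> 'a) \<Rightarrow> bool" where
  "closed_operator D A \<longleftrightarrow> closed {(x, A x) | x. x \<in> D}"

definition densely_defined :: "'a::complex_banach set \<Rightarrow> bool" where
  "densely_defined D \<longleftrightarrow> closure D = UNIV"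

definition resolvent_set :: "'a::complex_banach set \<Rightarrow> ('a \<Rightarrow> 'a) \<Rightarrow> complex set" where
  "resolvent_set D A =
     {z. \<exists>R. bounded_clinear R \<and>
             (\<forall>x. R x \<in> D \<and> A (R x) - z *\<^sub>C R x = x) \<and>
             (\<forall>x\<in>D. R (A x - z *\<^sub>C x) = x)}"

definition spectrum :: "'a::complex_banach set \<Rightarrow> ('a \<Rightarrow> 'a) \<Rightarrow> complex set" where
  "spectrum D A = - resolvent_set D A"

definition adjoint_domain :: "'a::complex_banach set \<Rightarrow> ('a \<Rightarrow> 'a) \<Rightarrow> ('a \<Rightarrow> complex) set" where
  "adjoint_domain D A =
     {g. bounded_clinear g \<and> (\<exists>h. bounded_clinear h \<and> (\<forall>x\<in>D. g (A x) = h x))}"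

text \<open>The functional described here is unique as soon as \<open>D\<close> is dense.\<close>

definition adjoint_op ::
    "'a::complex_banach set \<Rightarrow> ('a \<Rightarrow> 'a) \<Rightarrow> ('a \<Rightarrow> complex) \<Rightarrow> 'a \<Rightarrow> complex" where
  "adjoint_op D A g = (THE h. bounded_clinear h \<and> (\<forall>x\<in>D. g (A x) = h x))"

section \<open>Scalar type spectral operators\<close>

text \<open>Idempotence of each \<open>E \<delta>\<close> is the case \<open>\<sigma> = \<delta>\<close> of multiplicativity. The values of
  \<open>E\<close> on sets that are not Borel play no role.\<close>

definition spectral_measure :: "(complex set \<Rightarrow> 'a::complex_banach \<Rightarrow> 'a) \<Rightarrow> bool" where
  "spectral_measure E \<longleftrightarrow>
     (\<forall>\<delta>\<in>sets borel. bounded_clinear (E \<delta>)) \<and>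
     (\<forall>x. E {} x = 0) \<and>
     (\<forall>x. E UNIV x = x) \<and>
     (\<forall>\<delta>\<in>sets borel. \<forall>\<sigma>\<in>sets borel. \<forall>x. E \<delta> (E \<sigma> x) = E (\<delta> \<inter> \<sigma>) x) \<and>
     (\<forall>\<Delta>::nat \<Rightarrow> complex set. range \<Delta> \<subseteq> sets borel \<and> disjoint_family \<Delta> \<longrightarrow>
        (\<forall>x. (\<lambda>n. E (\<Delta> n) x) sums E (\<Union>n. \<Delta> n) x))"

definition spectral_support :: "(complex set \<Rightarrow> 'a::complex_banach \<Rightarrow> 'a) \<Rightarrow> complex set" where
  "spectral_support E = {z. \<forall>U. open U \<and> z \<in> U \<longrightarrow> (\<exists>x. E U x \<noteq> 0)}"

definition simple_spectral_integral ::
    "(complex set \<Rightarrow> 'a::complex_banach \<Rightarrow> 'a) \<Rightarrow> (complex \<Rightarrow> complex) \<Rightarrow> 'a \<Rightarrow> 'a" where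
  "simple_spectral_integral E s x = (\<Sum>c\<in>range s. c *\<^sub>C E (s -` {c}) x)"

text \<open>The integral of a bounded Borel function is the limit, in operator norm, of the integrals
  of simple Borel functions that approximate it uniformly; it is unspecified for other
  functions.\<close>

definition spectral_integral ::
    "(complex set \<Rightarrow> 'a::complex_banach \<Rightarrow> 'a) \<Rightarrow> (complex \<Rightarrow> complex) \<Rightarrow> 'a \<Rightarrow> 'a" where
  "spectral_integral E F =
     (THE T. bounded_clinear T \<and>
        (\<forall>s. (\<forall>n. simple_function borel (s n)) \<and> uniform_limit UNIV s F sequentially \<longrightarrow>
             (\<lambda>n. onorm (\<lambda>x. simple_spectral_integral E (s n) x - T x)) \<longlonglongrightarrow> 0))"

definition spectral_integral_on ::
    "(complex set \<Rightarrow> 'a::complex_banach \<Rightarrow> 'a) \<Rightarrow> complex set \<Rightarrow> (complex \<Rightarrow> complex) \<Rightarrow> 'a \<Rightarrow> 'a" where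
  "spectral_integral_on E \<delta> F = spectral_integral E (\<lambda>z. if z \<in> \<delta> then F z else 0)"

definition resolution_of_identity ::
    "'a::complex_banach set \<Rightarrow> ('a \<Rightarrow> 'a) \<Rightarrow> (complex set \<Rightarrow> 'a \<Rightarrow> 'a) \<Rightarrow> bool" where
  "resolution_of_identity D A E \<longleftrightarrow>
     spectral_measure E \<and>
     spectral_support E = spectrum D A \<and>
     (let I = (\<lambda>n::nat. spectral_integral_on E {z \<in> spectrum D A. cmod z \<le> real n} (\<lambda>z. z))
      in D = {f. convergent (\<lambda>n. I n f)} \<and> (\<forall>f\<in>D. (\<lambda>n. I n f) \<longlonglongrightarrow> A f))"

definition scalar_type_spectral_operator :: "'a::complex_banach set \<Rightarrow> ('a \<Rightarrow> 'a) \<Rightarrow> bool" where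
  "scalar_type_spectral_operator D A \<longleftrightarrow>
     linear_operator D A \<and> closed_operator D A \<and> densely_defined D \<and>
     (\<exists>E. resolution_of_identity D A E)"

section \<open>Weak solutions and entire vector functions\<close>

text \<open>Functions on \<open>[0,\<infinity>)\<close> are total functions whose values at negative arguments are
  irrelevant; the derivative at \<open>0\<close> is one-sided.\<close>

definition weak_solution :: "'a::complex_banach set \<Rightarrow> ('a \<Rightarrow> 'a) \<Rightarrow> (real \<Rightarrow> 'a) \<Rightarrow> bool" where
  "weak_solution D A y \<longleftrightarrow>
     continuous_on {0..} y \<and>
     (\<forall>g\<in>adjoint_domain D A. \<forall>t\<ge>0.
        ((\<lambda>s. g (y s)) has_vector_derivative adjoint_op D A g (y t)) (at t within {0..}))"

text \<open>The library's \<open>holomorphic_on\<close> is restricted to functions into normed fields.\<close>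

definition entire :: "(complex \<Rightarrow> 'a::complex_banach) \<Rightarrow> bool" where
  "entire F \<longleftrightarrow> (\<forall>z. \<exists>L. ((\<lambda>w. inverse (w - z) *\<^sub>C (F w - F z)) \<longlongrightarrow> L) (at z))"

definition entire_vector_function :: "(real \<Rightarrow> 'a::complex_banach) \<Rightarrow> bool" where
  "entire_vector_function y \<longleftrightarrow>
     (\<exists>F. entire F \<and> (\<forall>t\<ge>0. F (complex_of_real t) = y t))"

definition sector :: "real \<Rightarrow> complex set" where
  "sector b = {z. Re z \<ge> b * \<bar>Im z\<bar>}"

end

theory Submission imports Defs "HOL-Complex_Analysis.Conformal_Mappings" begin

text \<open>
  Write \<open>\<Phi> F = \<integral> F dE\<close> for a bounded Borel function \<open>F\<close>, where \<open>E\<close> is the resolution of the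
  identity. The map \<open>\<Phi>\<close> is linear, multiplicative and satisfies
  \<open>\<parallel>\<Phi> F\<parallel> \<le> 4 M sup \<bar>F\<bar>\<close>, where \<open>M\<close> bounds all the projections \<open>E \<delta>\<close> (\<open>uniformly_bounded_E\<close>,
  \<open>calculus_mult\<close>, \<open>norm_calculus_le\<close>). Everything is reduced to estimates of scalar functions on the
  spectrum through this inequality. In particular, if \<open>w(\<lambda>) e\<^bsup>z\<lambda>\<^esup>\<close> stays bounded with exponential room
  to spare, then \<open>z \<mapsto> \<Phi> (w e\<^bsup>z\<lambda>\<^esup>)\<close> is complex differentiable in operator norm, with derivative
  \<open>\<Phi> (\<lambda> w e\<^bsup>z\<lambda>\<^esup>)\<close> (\<open>calculus_exp_difference_quotient_le\<close>).

  A weak solution \<open>y\<close> is \<open>e\<^bsup>tA\<^esup> y(0)\<close> on every bounded part of the spectrum: cut down by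
  \<open>E {\<bar>\<lambda>\<bar> \<le> n}\<close>, the operator is bounded, and \<open>e\<^bsup>-tA\<^esup> y(t)\<close> has weak derivative 0, hence is constant
  since functionals separate points (\<open>weak_solution_truncation\<close>, \<open>separating_functional\<close>).

  Suppose that, up to a bounded set, the spectrum lies in the sector \<open>Re \<lambda> \<ge> b \<bar>Im \<lambda>\<bar>\<close>. There
  \<open>\<bar>\<lambda>\<bar> \<le> c Re \<lambda>\<close> with \<open>c = 1 + 1/b\<close>, so that \<open>\<bar>e\<^bsup>z\<lambda>\<^esup>\<bar>\<close> is dominated by \<open>e\<^bsup>t Re \<lambda>\<^esup>\<close> as soon as
  \<open>t \<ge> c \<bar>z\<bar>\<close>. Hence \<open>e\<^bsup>zA\<^esup> y(0) = \<Phi> (e\<^bsup>(z-t)\<lambda>\<^esup>) y(t)\<close> makes sense for every complex \<open>z\<close>, is independent of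
  the choice of \<open>t\<close>, and is the entire continuation of \<open>y\<close> (\<open>weak_solution_entire\<close>).

  Suppose on the contrary that the spectrum is unbounded outside every such sector. Choose points
  \<open>p\<^sub>k\<close> of the spectrum with \<open>Re p\<^sub>k < \<bar>Im p\<^sub>k\<bar> / (k + 1)\<close> and \<open>\<bar>p\<^sub>k\<bar> \<ge> 2k\<close>, having disjoint unit discs \<open>\<Delta>\<^sub>k\<close> around
  them, and a vector \<open>f\<close> with \<open>\<parallel>E \<Delta>\<^sub>k f\<parallel> = 2\<^bsup>-k\<^esup>\<close>. Weighting by \<open>e\<^bsup>-\<bar>\<lambda>\<bar>\<^esup>\<close> on the union of the discs tames
  \<open>e\<^bsup>t\<lambda>\<^esup>\<close> for all \<open>t \<ge> 0\<close>, because far out \<open>Re \<lambda>\<close> is at most a small multiple of \<open>\<bar>\<lambda>\<bar>\<close>; this gives a weak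
  solution \<open>y(t) = \<Phi> (w e\<^bsup>t\<lambda>\<^esup>) f\<close>. An entire continuation would, by the identity theorem, equal
  \<open>\<Phi> (w e\<^bsup>z\<lambda>\<^esup>) f\<close> on each disc for all complex \<open>z\<close>. But one of the times \<open>z = 4\<i>, -4\<i>, -4\<close> makes
  \<open>Re (z p\<^sub>k) \<ge> 2 \<bar>p\<^sub>k\<bar>\<close>, which beats the weight, and for one of the three this happens for infinitely
  many \<open>k\<close>; the continuation would be infinite at that time
  (\<open>exists_weak_solution_not_entire\<close>).
\<close>

section \<open>Complex scalar multiplication\<close>

lemma bounded_bilinear_scaleC:
  "bounded_bilinear ((*\<^sub>C) :: complex \<Rightarrow> 'a::complex_banach \<Rightarrow> 'a)"
proof
  fix r :: real and a b :: complex and x y :: 'a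
  show "(r *\<^sub>R a) *\<^sub>C x = r *\<^sub>R a *\<^sub>C x"
    by (simp add: scaleR_conv_of_real scaleC_scaleC [symmetric] scaleC_of_real)
  show "a *\<^sub>C r *\<^sub>R x = r *\<^sub>R a *\<^sub>C x"
    by (simp add: scaleC_of_real [symmetric] scaleC_scaleC mult.commute)
  show "\<exists>K. \<forall>(a::complex) (b::'a). norm (a *\<^sub>C b) \<le> norm a * norm b * K"
    by (rule exI [of _ 1]) (simp add: norm_scaleC)
qed (simp_all add: scaleC_add_left scaleC_add_right)

interpretation scaleC: bounded_bilinear "(*\<^sub>C) :: complex \<Rightarrow> 'a::complex_banach \<Rightarrow> 'a"
  by (rule bounded_bilinear_scaleC)

lemma scaleC_one [simp]: "1 *\<^sub>C x = (x::'a::complex_banach)"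
  using scaleC_of_real [of 1 x] by simp

lemma scaleC_minus_one: "(-1) *\<^sub>C x = - (x::'a::complex_banach)"
  using scaleC.minus_left [of 1 x] by simp

lemma bounded_clinear_imp_bounded_linear: "bounded_clinear f \<Longrightarrow> bounded_linear f"
  by (simp add: bounded_clinear_def)

lemma bounded_clinear_scaleC: "bounded_clinear f \<Longrightarrow> f (c *\<^sub>C x) = c *\<^sub>C f x"
  by (simp add: bounded_clinear_def)

lemma bounded_clinear_compose:
  "bounded_clinear f \<Longrightarrow> bounded_clinear g \<Longrightarrow> bounded_clinear (\<lambda>x. f (g x))"
  by (auto simp: bounded_clinear_def intro: bounded_linear_compose)

section \<open>Bounded functionals separate points\<close>

definition sublinear :: "('a::real_vector \<Rightarrow> real) \<Rightarrow> bool" where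
  "sublinear p \<longleftrightarrow>
     (\<forall>x y. p (x + y) \<le> p x + p y) \<and> (\<forall>r\<ge>0. \<forall>x. p (r *\<^sub>R x) = r * p x)"

lemma sublinear_add: "sublinear p \<Longrightarrow> p (x + y) \<le> p x + p y"
  by (simp add: sublinear_def)

lemma sublinear_scaleR: "sublinear p \<Longrightarrow> 0 \<le> r \<Longrightarrow> p (r *\<^sub>R x) = r * p x"
  by (simp add: sublinear_def)

lemma sublinear_zero: "sublinear p \<Longrightarrow> p 0 = 0"
  using sublinear_scaleR [of p 0 0] by simp

lemma sublinear_minus_le: "sublinear p \<Longrightarrow> - p (- x) \<le> p x"
  using sublinear_add [of p x "- x"] sublinear_zero [of p] by simp

text \<open>The amount by which \<open>p\<close> grows along \<open>a\<close> can be subtracted without losing sublinearity.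
  The result lies below \<open>p\<close> and its value at \<open>- a\<close> is at most \<open>- p a\<close>; for a minimal \<open>p\<close> this
  forces additivity.\<close>

definition sublinear_shift :: "('a::real_vector \<Rightarrow> real) \<Rightarrow> 'a \<Rightarrow> 'a \<Rightarrow> real" where
  "sublinear_shift p a x = (INF t\<in>{0..}. p (x + t *\<^sub>R a) - t * p a)"

lemma sublinear_shift_lower:
  assumes "sublinear p" "0 \<le> t"
  shows "- p (- x) \<le> p (x + t *\<^sub>R a) - t * p a"
  using sublinear_add [of p "x + t *\<^sub>R a" "- x"] sublinear_scaleR [of p t a] assms by simp

lemma sublinear_shift_le:
  assumes "sublinear p" "0 \<le> t"
  shows "sublinear_shift p a x \<le> p (x + t *\<^sub>R a) - t * p a"
  unfolding sublinear_shift_def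
proof (rule cINF_lower)
  show "bdd_below ((\<lambda>t. p (x + t *\<^sub>R a) - t * p a) ` {0..})"
    using sublinear_shift_lower [OF assms(1)] by (intro bdd_belowI2 [where m = "- p (- x)"]) simp
qed (use assms in simp)

lemma sublinear_shift_greatest:
  assumes "\<And>t. 0 \<le> t \<Longrightarrow> m \<le> p (x + t *\<^sub>R a) - t * p a"
  shows "m \<le> sublinear_shift p a x"
  unfolding sublinear_shift_def by (rule cINF_greatest) (use assms in auto)

lemma sublinear_sublinear_shift:
  assumes p: "sublinear p"
  shows "sublinear (sublinear_shift p a)"
  unfolding sublinear_def
proof (intro conjI allI impI)
  let ?q = "sublinear_shift p a"
  fix x y
  have *: "?q (x + y) \<le> (p (x + s *\<^sub>R a) - s * p a) + (p (y + t *\<^sub>R a) - t * p a)"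
    if "0 \<le> s" "0 \<le> t" for s t
    using sublinear_shift_le [OF p, of "s + t" a "x + y"] that
      sublinear_add [OF p, of "x + s *\<^sub>R a" "y + t *\<^sub>R a"]
    by (simp add: algebra_simps)
  have "?q (x + y) - (p (x + s *\<^sub>R a) - s * p a) \<le> ?q y" if "0 \<le> s" for s
    using *[OF that] by (intro sublinear_shift_greatest) (simp add: algebra_simps)
  then have "?q (x + y) - ?q y \<le> ?q x"
    by (intro sublinear_shift_greatest) (simp add: algebra_simps)
  then show "?q (x + y) \<le> ?q x + ?q y"
    by simp
next
  let ?q = "sublinear_shift p a"
  have le: "r * ?q x \<le> ?q (r *\<^sub>R x)" if "r > 0" for r x
  proof (rule sublinear_shift_greatest)
    fix t :: real assume t: "0 \<le> t"
    have "r * ?q x \<le> r * (p (x + (t / r) *\<^sub>R a) - (t / r) * p a)"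
      using sublinear_shift_le [OF p, of "t / r" a x] that t by simp
    also have "\<dots> = p (r *\<^sub>R (x + (t / r) *\<^sub>R a)) - t * p a"
      using that sublinear_scaleR [OF p, of r "x + (t / r) *\<^sub>R a"] by (simp add: algebra_simps)
    also have "\<dots> = p (r *\<^sub>R x + t *\<^sub>R a) - t * p a"
      using that by (simp add: algebra_simps)
    finally show "r * ?q x \<le> p (r *\<^sub>R x + t *\<^sub>R a) - t * p a" .
  qed
  fix r :: real and x assume "0 \<le> r"
  then consider "r = 0" | "r > 0" by linarith
  then show "?q (r *\<^sub>R x) = r * ?q x"
  proof cases
    case 1
    have "?q 0 \<le> 0"
      using sublinear_shift_le [OF p, of 0 a 0] sublinear_zero [OF p] by simp
    moreover have "0 \<le> ?q 0"
      using sublinear_scaleR [OF p] by (intro sublinear_shift_greatest) simp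
    ultimately show ?thesis using 1 by simp
  next
    case 2
    have "inverse r * ?q (r *\<^sub>R x) \<le> ?q (inverse r *\<^sub>R (r *\<^sub>R x))"
      using 2 by (intro le) simp
    then have "?q (r *\<^sub>R x) \<le> r * ?q x"
      using 2 by (simp add: field_simps)
    with le [OF 2, of x] show ?thesis by linarith
  qed
qed

text \<open>Lower bounds of chains for Zorn's lemma. Subadditivity of the infimum needs the chain: values of
  two members are bounded below by those of the smaller one. The norm keeps the infimum finite.\<close>

lemma sublinear_INF:
  assumes ne: "C \<noteq> {}" and sub: "\<And>p. p \<in> C \<Longrightarrow> sublinear p"
    and le: "\<And>p x. p \<in> C \<Longrightarrow> p x \<le> norm x"
    and chain: "\<And>p q. p \<in> C \<Longrightarrow> q \<in> C \<Longrightarrow> p \<le> q \<or> q \<le> p"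
  shows "sublinear (\<lambda>x. INF p\<in>C. p x)" and "\<And>p x. p \<in> C \<Longrightarrow> (INF p\<in>C. p x) \<le> p x"
proof -
  have low: "- norm x \<le> p x" if "p \<in> C" for p x
    using sublinear_minus_le [OF sub [OF that], of x] le [OF that, of "- x"] by simp
  have bdd: "bdd_below ((\<lambda>p. p x) ` C)" for x
    by (rule bdd_belowI2 [where m = "- norm x"]) (rule low)
  show lower: "(INF p\<in>C. p x) \<le> p x" if "p \<in> C" for p x
    by (rule cINF_lower [OF bdd that])
  show "sublinear (\<lambda>x. INF p\<in>C. p x)"
    unfolding sublinear_def
  proof (intro conjI allI impI)
    fix x y
    have *: "(INF p\<in>C. p (x + y)) \<le> p x + q y" if pq: "p \<in> C" "q \<in> C" for p q
    proof -
      obtain r where r: "r \<in> C" "r \<le> p" "r \<le> q"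
        using chain [OF pq] pq by blast
      have "(INF p\<in>C. p (x + y)) \<le> r x + r y"
        using lower [OF r(1)] sublinear_add [OF sub [OF r(1)]] order_trans by blast
      also have "\<dots> \<le> p x + q y"
        using r by (intro add_mono) (auto simp: le_fun_def)
      finally show ?thesis .
    qed
    have "(INF p\<in>C. p (x + y)) - p x \<le> (INF p\<in>C. p y)" if "p \<in> C" for p
      using *[OF that] by (intro cINF_greatest [OF ne]) (simp add: algebra_simps)
    then have "(INF p\<in>C. p (x + y)) - (INF p\<in>C. p y) \<le> (INF p\<in>C. p x)"
      by (intro cINF_greatest [OF ne]) (simp add: algebra_simps)
    then show "(INF p\<in>C. p (x + y)) \<le> (INF p\<in>C. p x) + (INF p\<in>C. p y)"
      by simp
  next
    fix r :: real and x assume r: "0 \<le> r"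
    have le: "(INF p\<in>C. p (r *\<^sub>R x)) \<ge> r * (INF p\<in>C. p x)" if "0 \<le> r" for r x
    proof (rule cINF_greatest [OF ne])
      fix p assume p: "p \<in> C"
      show "r * (INF p\<in>C. p x) \<le> p (r *\<^sub>R x)"
        using sublinear_scaleR [OF sub [OF p] that, of x] lower [OF p, of x] that
        by (simp add: mult_left_mono)
    qed
    show "(INF p\<in>C. p (r *\<^sub>R x)) = r * (INF p\<in>C. p x)"
    proof (cases "r = 0")
      case True
      have "(INF p\<in>C. p (0::'a)) = (INF p\<in>C. 0)"
        by (rule INF_cong) (use sublinear_zero sub in auto)
      then show ?thesis using True ne by simp
    next
      case False
      then have "inverse r * (INF p\<in>C. p (r *\<^sub>R x)) \<le> (INF p\<in>C. p x)"
        using le [of "inverse r" "r *\<^sub>R x"] r by simp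
      then have "(INF p\<in>C. p (r *\<^sub>R x)) \<le> r * (INF p\<in>C. p x)"
        using False r by (simp add: field_simps)
      with le [OF r, of x] show ?thesis by linarith
    qed
  qed
qed

lemma sublinear_norm: "sublinear (norm :: 'a::real_normed_vector \<Rightarrow> real)"
  by (simp add: sublinear_def norm_triangle_ineq)

text \<open>Hahn-Banach theorem. Zorn's lemma gives a minimal sublinear functional \<open>m\<close> below \<open>p\<close>. Its shift
  along any \<open>a\<close> is sublinear and below \<open>m\<close>, hence equal to \<open>m\<close>, and this equality says
  \<open>m x + m a \<le> m (x + a)\<close>.\<close>

lemma exists_linear_below_sublinear:
  fixes p :: "'a::real_normed_vector \<Rightarrow> real"
  assumes p: "sublinear p" and p_le: "\<And>x. p x \<le> norm x"
  obtains f where "bounded_linear f" "\<And>x. f x \<le> p x"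
proof -
  define S where "S = {q. sublinear q \<and> (\<forall>x. q x \<le> p x)}"
  let ?P = "\<lambda>q r::'a \<Rightarrow> real. r \<le> q"
  have "\<exists>m\<in>S. \<forall>q\<in>S. ?P m q \<longrightarrow> q = m"
  proof (rule predicate_Zorn)
    show "partial_order_on S (relation_of ?P S)"
      by (rule partial_order_on_relation_ofI) auto
    fix C assume C: "C \<in> Chains (relation_of ?P S)"
    then have CS: "C \<subseteq> S"
      by (rule Chains_relation_of)
    show "\<exists>u\<in>S. \<forall>a\<in>C. ?P a u"
    proof (cases "C = {}")
      case True
      then show ?thesis using p by (auto simp: S_def)
    next
      case False
      have ch: "q \<le> r \<or> r \<le> q" if "q \<in> C" "r \<in> C" for q r
        using C that by (auto simp: Chains_def relation_of_def)
      have le: "q x \<le> norm x" if "q \<in> C" for q x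
        using that CS by (intro order_trans [OF _ p_le [of x]]) (auto simp: S_def)
      have sub: "sublinear q" if "q \<in> C" for q
        using that CS by (auto simp: S_def)
      have I1: "sublinear (\<lambda>x. INF q\<in>C. q x)"
        by (rule sublinear_INF(1) [OF False]) (use sub le ch in blast)+
      have I2: "(INF q\<in>C. q x) \<le> q x" if "q \<in> C" for q x
        by (rule sublinear_INF(2) [OF False]) (use sub le ch that in blast)+
      obtain q where q: "q \<in> C" using False by auto
      have "q x \<le> p x" for x
        using q CS by (auto simp: S_def)
      then have "(\<lambda>x. INF q\<in>C. q x) \<in> S"
        using I1 order_trans [OF I2 [OF q]] by (simp add: S_def)
      then show ?thesis
        using I2 by (auto simp: le_fun_def intro!: bexI [of _ "\<lambda>x. INF q\<in>C. q x"])
    qed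
  qed
  then obtain m where m: "m \<in> S" and min: "\<And>q. q \<in> S \<Longrightarrow> q \<le> m \<Longrightarrow> q = m"
    by auto
  have sm: "sublinear m" and mp: "\<And>x. m x \<le> p x"
    using m by (auto simp: S_def)
  have shift: "sublinear_shift m a = m" for a
  proof (rule min)
    have le: "sublinear_shift m a x \<le> m x" for x
      using sublinear_shift_le [OF sm, of 0 a x] by simp
    then show "sublinear_shift m a \<le> m"
      by (simp add: le_fun_def)
    show "sublinear_shift m a \<in> S"
      using sublinear_sublinear_shift [OF sm] order_trans [OF le mp] by (simp add: S_def)
  qed
  have add: "m (x + a) = m x + m a" for x a
    using sublinear_shift_le [OF sm, of 1 a x] sublinear_add [OF sm, of x a] by (simp add: shift)
  have minus: "m (- x) = - m x" for x
    using add [of x "- x"] sublinear_zero [OF sm] by simp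
  have scale: "m (r *\<^sub>R x) = r *\<^sub>R m x" for r x
  proof (cases "0 \<le> r")
    case False
    then have "m (r *\<^sub>R x) = - m ((- r) *\<^sub>R x)"
      using minus [of "(- r) *\<^sub>R x"] by simp
    then show ?thesis
      using sublinear_scaleR [OF sm, of "- r" x] False by simp
  qed (simp add: sublinear_scaleR [OF sm])
  have "norm (m x) \<le> norm x * 1" for x
    using mp [of x] mp [of "- x"] p_le [of x] p_le [of "- x"] minus [of x] by (simp add: abs_le_iff)
  then have "bounded_linear m"
    by (rule bounded_linear_intro [OF add scale])
  then show ?thesis
    using mp that by blast
qed

text \<open>The norm shifted along \<open>x\<close> is at most \<open>- \<parallel>x\<parallel>\<close> at \<open>- x\<close>, so a real functional \<open>f\<close> below it does
  not vanish at \<open>x\<close>; it is the real part of the complex functional \<open>z \<mapsto> f z - \<i> f (\<i> z)\<close>.\<close>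

theorem separating_functional:
  fixes x :: "'a::complex_banach"
  assumes "x \<noteq> 0"
  obtains g :: "'a \<Rightarrow> complex" where "bounded_clinear g" "g x \<noteq> 0"
proof -
  obtain f where f: "bounded_linear f" and le: "\<And>z. f z \<le> sublinear_shift norm x z"
    using exists_linear_below_sublinear [OF sublinear_sublinear_shift [OF sublinear_norm, of x]]
      sublinear_shift_le [OF sublinear_norm, of 0 x] by auto
  interpret f: bounded_linear f by (rule f)
  have "f (- x) \<le> - norm x"
    using le [of "- x"] sublinear_shift_le [OF sublinear_norm, of 1 x "- x"] by simp
  then have fx: "f x \<noteq> 0"
    using assms by (auto simp: linear_neg [OF f.linear])
  define g where "g z = complex_of_real (f z) - \<i> * complex_of_real (f (\<i> *\<^sub>C z))" for z
  have lin: "bounded_linear g"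
    unfolding g_def
    by (intro bounded_linear_sub bounded_linear_const_mult
        bounded_linear_compose [OF bounded_linear_of_real] f
        bounded_linear_compose [OF f] scaleC.bounded_linear_right)
  interpret g: bounded_linear g by (rule lin)
  have i: "g (\<i> *\<^sub>C z) = \<i> * g z" for z
    by (simp add: g_def scaleC_scaleC scaleC_minus_one linear_neg [OF f.linear] algebra_simps)
  have "g (c *\<^sub>C z) = c * g z" for c z
  proof -
    have "c *\<^sub>C z = (complex_of_real (Re c) + \<i> * complex_of_real (Im c)) *\<^sub>C z"
      by (metis complex_eq)
    also have "\<dots> = Re c *\<^sub>R z + \<i> *\<^sub>C Im c *\<^sub>R z"
      by (simp only: scaleC_add_left scaleC_scaleC [symmetric] scaleC_of_real)
    finally have "g (c *\<^sub>C z) = (complex_of_real (Re c) + \<i> * complex_of_real (Im c)) * g z"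
      by (simp only: g.add g.scaleR i) (simp add: scaleR_conv_of_real algebra_simps)
    then show ?thesis
      by (metis complex_eq)
  qed
  then have "bounded_clinear g"
    using lin by (simp add: bounded_clinear_def scaleC_complex_def)
  moreover have "g x \<noteq> 0"
    using fx by (simp add: g_def complex_eq_iff)
  ultimately show ?thesis
    using that by blast
qed

corollary eq_if_functionals_eq:
  fixes x y :: "'a::complex_banach"
  assumes "\<And>g :: 'a \<Rightarrow> complex. bounded_clinear g \<Longrightarrow> g x = g y"
  shows "x = y"
proof (rule ccontr)
  assume "x \<noteq> y"
  then obtain g :: "'a \<Rightarrow> complex" where g: "bounded_clinear g" "g (x - y) \<noteq> 0"
    using separating_functional [of "x - y"] by auto
  then show False
    using assms [OF g(1)]
    by (simp add: bounded_linear.linear linear_diff bounded_clinear_imp_bounded_linear)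
qed

section \<open>Spectral measures are uniformly bounded\<close>

locale spectral_measure_on_complex =
  fixes E :: "complex set \<Rightarrow> 'a::complex_banach \<Rightarrow> 'a"
  assumes spectral_measure: "spectral_measure E"
begin

lemma bounded_clinear_E: "\<delta> \<in> sets borel \<Longrightarrow> bounded_clinear (E \<delta>)"
  using spectral_measure by (simp add: spectral_measure_def)

lemma bounded_linear_E: "\<delta> \<in> sets borel \<Longrightarrow> bounded_linear (E \<delta>)"
  by (rule bounded_clinear_imp_bounded_linear [OF bounded_clinear_E])

lemma E_empty [simp]: "E {} x = 0"
  using spectral_measure by (simp add: spectral_measure_def)

lemma E_UNIV [simp]: "E UNIV x = x"
  using spectral_measure by (simp add: spectral_measure_def)

lemma E_Int: "\<delta> \<in> sets borel \<Longrightarrow> \<sigma> \<in> sets borel \<Longrightarrow> E \<delta> (E \<sigma> x) = E (\<delta> \<inter> \<sigma>) x"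
  using spectral_measure by (simp add: spectral_measure_def)

lemma E_sums:
  "(\<And>n. \<Delta> n \<in> sets borel) \<Longrightarrow> disjoint_family \<Delta> \<Longrightarrow> (\<lambda>n::nat. E (\<Delta> n) x) sums E (\<Union>n. \<Delta> n) x"
  using spectral_measure unfolding spectral_measure_def by blast

lemma E_Un:
  assumes "A \<in> sets borel" "B \<in> sets borel" "A \<inter> B = {}"
  shows "E (A \<union> B) x = E A x + E B x"
proof -
  define \<Delta> where "\<Delta> n = (if n = 0 then A else if n = 1 then B else {})" for n :: nat
  have "(\<lambda>n. E (\<Delta> n) x) sums E (\<Union>n. \<Delta> n) x"
    by (rule E_sums) (use assms in \<open>auto simp: \<Delta>_def disjoint_family_on_def\<close>)
  moreover have "(\<Union>n. \<Delta> n) = A \<union> B"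
    by (auto simp: \<Delta>_def split: if_splits intro: exI [of _ 0] exI [of _ 1])
  moreover have "(\<lambda>n. E (\<Delta> n) x) sums (\<Sum>n\<in>{0,1}. E (\<Delta> n) x)"
    by (rule sums_finite) (auto simp: \<Delta>_def)
  ultimately show ?thesis
    using sums_unique2 by (fastforce simp: \<Delta>_def)
qed

lemma E_UN_finite:
  assumes "finite I" "\<And>i. i \<in> I \<Longrightarrow> A i \<in> sets borel" "disjoint_family_on A I"
  shows "E (\<Union>i\<in>I. A i) x = (\<Sum>i\<in>I. E (A i) x)"
  using assms
proof (induction I)
  case (insert j I)
  have "E (A j \<union> (\<Union>i\<in>I. A i)) x = E (A j) x + E (\<Union>i\<in>I. A i) x"
  proof (rule E_Un)
    show "A j \<inter> (\<Union>i\<in>I. A i) = {}"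
      using insert.prems(2) insert.hyps(2) by (fastforce simp: disjoint_family_on_def)
  qed (use insert in \<open>auto intro!: sets.finite_UN\<close>)
  then show ?case
    using insert by (simp add: disjoint_family_on_def)
qed simp

lemma E_split:
  "A \<in> sets borel \<Longrightarrow> B \<in> sets borel \<Longrightarrow> E A x = E (A \<inter> B) x + E (A - B) x"
  using E_Un [of "A \<inter> B" "A - B" x] by (auto simp: Int_Diff_Un)

text \<open>If \<open>\<parallel>E \<delta> x\<parallel>\<close> were unbounded, call a set unbounded when its Borel subsets already witness
  this. An unbounded set splits into two pieces on which \<open>\<parallel>E \<delta> x\<parallel> > 1\<close>, one of which is again
  unbounded. Iterating on that piece leaves a disjoint sequence of pieces with \<open>\<parallel>E \<delta> x\<parallel> > 1\<close>,
  whose sum cannot converge.\<close>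

lemma bounded_E_at: "\<exists>K. \<forall>\<delta>\<in>sets borel. norm (E \<delta> x) \<le> K"
proof (rule ccontr)
  assume unb: "\<not> ?thesis"
  define bad where
    "bad S \<longleftrightarrow> S \<in> sets borel \<and> (\<forall>K. \<exists>T\<in>sets borel. T \<subseteq> S \<and> norm (E T x) > K)" for S
  have step: "\<exists>S'. bad S' \<and> S' \<subseteq> S \<and> norm (E (S - S') x) > 1" if S: "bad S" for S
  proof -
    obtain T where T: "T \<in> sets borel" "T \<subseteq> S" "norm (E T x) > norm (E S x) + 1"
      using S unfolding bad_def by meson
    have Sb: "S \<in> sets borel" using S by (simp add: bad_def)
    have "E S x = E T x + E (S - T) x"
      using E_split [OF Sb T(1), of x] T(2) by (simp add: Int_absorb1)
    then have big: "norm (E (S - T) x) > 1"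
      using T(3) norm_triangle_ineq2 [of "E T x" "E S x"] norm_minus_commute [of "E T x" "E S x"]
      by (simp add: algebra_simps)
    have bigT: "norm (E T x) > 1"
      using T(3) norm_ge_zero [of "E S x"] by linarith
    have "bad T \<or> bad (S - T)"
    proof (rule ccontr)
      assume not_bad: "\<not> ?thesis"
      have bounded: "\<exists>K. \<forall>U\<in>sets borel. U \<subseteq> V \<longrightarrow> norm (E U x) \<le> K"
        if "\<not> bad V" "V \<in> sets borel" for V
        using that unfolding bad_def not_less [symmetric] by blast
      obtain K where K: "\<And>U. U \<in> sets borel \<Longrightarrow> U \<subseteq> T \<Longrightarrow> norm (E U x) \<le> K"
        using bounded [of T] not_bad T(1) by blast
      obtain L where L: "\<And>U. U \<in> sets borel \<Longrightarrow> U \<subseteq> S - T \<Longrightarrow> norm (E U x) \<le> L"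
        using bounded [of "S - T"] not_bad T(1) Sb by blast
      obtain U where U: "U \<in> sets borel" "U \<subseteq> S" "norm (E U x) > K + L"
        using S unfolding bad_def by meson
      have "norm (E U x) \<le> norm (E (U \<inter> T) x) + norm (E (U - T) x)"
        using E_split [OF U(1) T(1), of x] norm_triangle_ineq by metis
      moreover have "norm (E (U \<inter> T) x) \<le> K"
        using U T by (intro K) auto
      moreover have "norm (E (U - T) x) \<le> L"
        using U T by (intro L) auto
      ultimately show False
        using U(3) by linarith
    qed
    then show ?thesis
    proof
      assume "bad T"
      then show ?thesis using T(2) big by blast
    next
      assume "bad (S - T)"
      moreover have "S - (S - T) = T" using T(2) by blast
      ultimately show ?thesis using bigT by (intro exI [of _ "S - T"]) auto
    qed
  qed
  have "bad UNIV"
    using unb by (auto simp: bad_def not_le)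
  with step obtain S where S: "\<And>n::nat. bad (S n)"
    "\<And>n. S (Suc n) \<subseteq> S n \<and> norm (E (S n - S (Suc n)) x) > 1"
    using dependent_nat_choice [of "\<lambda>n. bad" "\<lambda>n S S'. S' \<subseteq> S \<and> norm (E (S - S') x) > 1"] by blast
  have decr: "S n \<subseteq> S m" if "m \<le> n" for m n
    by (rule lift_Suc_antimono_le [where f = S, OF _ that]) (use S(2) in blast)
  have "disjoint_family (\<lambda>n. S n - S (Suc n))"
  proof -
    have "(S m - S (Suc m)) \<inter> (S n - S (Suc n)) = {}" if "m < n" for m n
      using decr [of "Suc m" n] that by auto
    then show ?thesis
      unfolding disjoint_family_on_def by (metis (no_types, lifting) Int_commute nat_neq_iff)
  qed
  then have "(\<lambda>n. E (S n - S (Suc n)) x) sums E (\<Union>n. S n - S (Suc n)) x"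
    by (intro E_sums) (use S(1) in \<open>auto simp: bad_def\<close>)
  then have "(\<lambda>n. E (S n - S (Suc n)) x) \<longlonglongrightarrow> 0"
    by (intro summable_LIMSEQ_zero) (auto simp: sums_iff)
  then have "\<forall>\<^sub>F n in sequentially. norm (E (S n - S (Suc n)) x) < 1"
    by (auto dest: tendstoD [of _ _ _ 1])
  then obtain n where "norm (E (S n - S (Suc n)) x) < 1"
    by (auto simp: eventually_sequentially)
  then show False
    using S(2) [of n] by simp
qed

text \<open>Uniform boundedness principle: by Baire's theorem one of the closed sets on which the
  orbits \<open>E \<delta> x\<close> are bounded by a fixed \<open>n\<close> contains a ball.\<close>

lemma uniformly_bounded_E:
  "\<exists>K\<ge>0. \<forall>\<delta>\<in>sets borel. \<forall>x. norm (E \<delta> x) \<le> K * norm x"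
proof -
  define C where "C n = {x. \<forall>\<delta>\<in>sets borel. norm (E \<delta> x) \<le> real n}" for n
  have "closed (C n)" for n
  proof -
    have "closed {x. norm (E \<delta> x) \<le> real n}" if "\<delta> \<in> sets borel" for \<delta>
      by (intro closed_Collect_le continuous_intros
          bounded_linear.continuous_on [OF bounded_linear_E [OF that]])
    moreover have "C n = (\<Inter>\<delta>\<in>sets borel. {x. norm (E \<delta> x) \<le> real n})"
      by (auto simp: C_def)
    ultimately show ?thesis by auto
  qed
  moreover have "x \<in> \<Union> (range C)" for x
  proof -
    obtain K where "\<forall>\<delta>\<in>sets borel. norm (E \<delta> x) \<le> K"
      using bounded_E_at by blast
    then have "x \<in> C (nat \<lceil>K\<rceil>)"
      using real_nat_ceiling_ge [of K] by (fastforce simp: C_def)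
    then show ?thesis by blast
  qed
  then have "\<Union> (range C) = UNIV" by blast
  moreover have "Met_TC.mcomplete TYPE('a)"
    by (simp add: complete_UNIV)
  ultimately have "\<exists>n. interior (C n) \<noteq> {}"
    using Met_TC.metric_Baire_category_alt [of "range C"]
    by (auto simp flip: closed_closedin)
  then obtain n x0 r where r: "r > 0" "ball x0 r \<subseteq> C n"
    by (metis ex_in_conv interior_subset mem_interior)
  have "norm (E \<delta> x) \<le> (4 * real n / r) * norm x" if d: "\<delta> \<in> sets borel" for \<delta> x
  proof (cases "x = 0")
    case True
    then show ?thesis using linear_0 [OF bounded_linear.linear [OF bounded_linear_E [OF d]]] by simp
  next
    case False
    interpret Ed: bounded_linear "E \<delta>" by (rule bounded_linear_E [OF d])
    define c where "c = r / (2 * norm x)"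
    have c: "c > 0" "norm (c *\<^sub>R x) < r"
      using r False by (auto simp: c_def field_simps)
    have "x0 \<in> C n" "x0 + c *\<^sub>R x \<in> C n"
      using r c by (auto intro!: subsetD [OF r(2)] simp: dist_norm)
    then have "norm (E \<delta> x0) \<le> n" "norm (E \<delta> (x0 + c *\<^sub>R x)) \<le> n"
      using d by (auto simp: C_def)
    then have "norm (E \<delta> (c *\<^sub>R x)) \<le> 2 * n"
      using norm_triangle_ineq4 [of "E \<delta> (x0 + c *\<^sub>R x)" "E \<delta> x0"] by (simp add: Ed.add)
    then have "c * norm (E \<delta> x) \<le> 2 * n"
      using c by (simp add: Ed.scaleR)
    then show ?thesis
      using c(1) r False by (simp add: c_def field_simps)
  qed
  moreover have "0 \<le> 4 * real n / r" using r by simp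
  ultimately show ?thesis by blast
qed

definition spectral_bound :: real where
  "spectral_bound = (SOME K. 0 \<le> K \<and> (\<forall>\<delta>\<in>sets borel. \<forall>x. norm (E \<delta> x) \<le> K * norm x))"

lemma spectral_bound_nonneg: "0 \<le> spectral_bound"
  and norm_E_le: "\<delta> \<in> sets borel \<Longrightarrow> norm (E \<delta> x) \<le> spectral_bound * norm x"
  using someI_ex [OF uniformly_bounded_E] by (auto simp: spectral_bound_def)

end

section \<open>Integrals of simple functions\<close>

text \<open>The norm is convex in each coefficient separately, so it is largest when all coefficients are
  0 or 1. The additional summand \<open>w\<close> collects, during the induction, the coefficients already fixed.\<close>

lemma norm_sum_convex_le:
  fixes v :: "'i \<Rightarrow> 'a::real_normed_vector"
  assumes "finite I" "\<And>S. S \<subseteq> I \<Longrightarrow> norm (w + sum v S) \<le> K"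
    and "\<And>i. i \<in> I \<Longrightarrow> 0 \<le> c i \<and> c i \<le> 1"
  shows "norm (w + (\<Sum>i\<in>I. c i *\<^sub>R v i)) \<le> K"
  using assms
proof (induction I arbitrary: w)
  case empty
  then show ?case by auto
next
  case (insert j I)
  let ?s = "\<Sum>i\<in>I. c i *\<^sub>R v i"
  have without: "norm (w + ?s) \<le> K"
    by (rule insert.IH) (use insert.prems in auto)
  have "with": "norm ((w + v j) + ?s) \<le> K"
  proof (rule insert.IH)
    fix S assume S: "S \<subseteq> I"
    then have "finite S" "j \<notin> S" using insert.hyps finite_subset by auto
    then show "norm (w + v j + sum v S) \<le> K"
      using insert.prems(1) [of "insert j S"] S by (auto simp: add.assoc)
  qed (use insert.prems in auto)
  have cj: "0 \<le> c j" "c j \<le> 1" using insert.prems(2) by auto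
  have "w + (\<Sum>i\<in>insert j I. c i *\<^sub>R v i) = c j *\<^sub>R ((w + v j) + ?s) + (1 - c j) *\<^sub>R (w + ?s)"
    using insert.hyps by (simp add: algebra_simps)
  also have "norm \<dots> \<le> c j * norm ((w + v j) + ?s) + (1 - c j) * norm (w + ?s)"
    using cj by (intro norm_triangle_le) simp
  also have "\<dots> \<le> c j * K + (1 - c j) * K"
    using cj without "with" by (intro add_mono mult_left_mono) auto
  finally show ?case by (simp add: algebra_simps)
qed

text \<open>Splitting the coefficients into positive and negative parts of their real and imaginary
  parts costs the factor 4.\<close>

lemma norm_sum_scaleC_le:
  fixes v :: "'i \<Rightarrow> 'a::complex_banach"
  assumes "finite I" "\<And>S. S \<subseteq> I \<Longrightarrow> norm (sum v S) \<le> K"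
    and c: "\<And>i. i \<in> I \<Longrightarrow> cmod (c i) \<le> B" and B: "0 \<le> B"
  shows "norm (\<Sum>i\<in>I. c i *\<^sub>C v i) \<le> 4 * K * B"
proof (cases "B = 0")
  case True
  then have "(\<Sum>i\<in>I. c i *\<^sub>C v i) = 0"
    using c by (intro sum.neutral) (auto simp: scaleC.zero_left)
  then show ?thesis using True by simp
next
  case False
  with B have B: "B > 0" by simp
  have *: "norm (\<Sum>i\<in>I. d i *\<^sub>R v i) \<le> K * B" if d: "\<And>i. i \<in> I \<Longrightarrow> 0 \<le> d i \<and> d i \<le> B" for d
  proof -
    have "norm (0 + (\<Sum>i\<in>I. (d i / B) *\<^sub>R v i)) \<le> K"
      by (rule norm_sum_convex_le) (use assms d B in \<open>auto simp: field_simps\<close>)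
    moreover have "(\<Sum>i\<in>I. (d i / B) *\<^sub>R v i) = inverse B *\<^sub>R (\<Sum>i\<in>I. d i *\<^sub>R v i)"
      by (simp add: scaleR_sum_right divide_inverse mult.commute)
    ultimately show ?thesis
      using B by (simp add: field_simps)
  qed
  define part where "part f = (\<Sum>i\<in>I. max 0 (f (c i)) *\<^sub>R v i)" for f :: "complex \<Rightarrow> real"
  have part: "norm (part f) \<le> K * B" if "\<And>z. \<bar>f z\<bar> \<le> cmod z" for f
    unfolding part_def
  proof (rule *)
    fix i assume "i \<in> I"
    then show "0 \<le> max 0 (f (c i)) \<and> max 0 (f (c i)) \<le> B"
      using that [of "c i"] c [of i] B by auto
  qed
  have split: "c i *\<^sub>C v i = (max 0 (Re (c i)) *\<^sub>R v i - max 0 (- Re (c i)) *\<^sub>R v i) +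
      \<i> *\<^sub>C (max 0 (Im (c i)) *\<^sub>R v i - max 0 (- Im (c i)) *\<^sub>R v i)" for i
  proof -
    have "c i *\<^sub>C v i = (complex_of_real (Re (c i)) + \<i> * complex_of_real (Im (c i))) *\<^sub>C v i"
      by (metis complex_eq)
    also have "\<dots> = Re (c i) *\<^sub>R v i + \<i> *\<^sub>C Im (c i) *\<^sub>R v i"
      by (simp only: scaleC_add_left scaleC_scaleC [symmetric] scaleC_of_real)
    also have "Re (c i) *\<^sub>R v i = max 0 (Re (c i)) *\<^sub>R v i - max 0 (- Re (c i)) *\<^sub>R v i"
      by (simp add: scaleR_diff_left [symmetric] max_def)
    also have "Im (c i) *\<^sub>R v i = max 0 (Im (c i)) *\<^sub>R v i - max 0 (- Im (c i)) *\<^sub>R v i"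
      by (simp add: scaleR_diff_left [symmetric] max_def)
    finally show ?thesis .
  qed
  have "(\<Sum>i\<in>I. c i *\<^sub>C v i) =
      (part Re - part (\<lambda>z. - Re z)) + \<i> *\<^sub>C (part Im - part (\<lambda>z. - Im z))"
    by (simp only: split part_def sum.distrib sum_subtractf scaleC.sum_right scaleC.diff_right)
  also have "norm \<dots> \<le> norm (part Re - part (\<lambda>z. - Re z)) + norm (part Im - part (\<lambda>z. - Im z))"
    by (rule norm_triangle_le) (simp add: norm_scaleC)
  also have "\<dots> \<le> (K * B + K * B) + (K * B + K * B)"
    by (intro add_mono order_trans [OF norm_triangle_ineq4] part)
      (simp_all add: abs_Re_le_cmod abs_Im_le_cmod)
  finally show ?thesis by (simp add: mult.commute)
qed

lemma simple_vimage: "simple_function borel p \<Longrightarrow> p -` B \<in> sets borel"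
  for p :: "complex \<Rightarrow> 'b"
  using simple_functionD(2) [of borel p B] by simp

lemma simple_finite_range: "simple_function borel p \<Longrightarrow> finite (range p)"
  for p :: "complex \<Rightarrow> 'b"
  using simple_functionD(1) [of borel p] by simp

context spectral_measure_on_complex
begin

text \<open>Any finite Borel partition on which the integrand is constant computes the integral; two
  simple functions can so be integrated over the common partition by the values of the pair.\<close>

lemma simple_spectral_integral_compose:
  fixes p :: "complex \<Rightarrow> 'b"
  assumes p: "simple_function borel p"
  shows "simple_spectral_integral E (\<lambda>z. \<phi> (p z)) x = (\<Sum>v\<in>range p. \<phi> v *\<^sub>C E (p -` {v}) x)"
proof -
  have "(\<Sum>v\<in>range p. \<phi> v *\<^sub>C E (p -` {v}) x) =
      (\<Sum>c\<in>\<phi> ` range p. \<Sum>v\<in>{v\<in>range p. \<phi> v = c}. \<phi> v *\<^sub>C E (p -` {v}) x)"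
    by (rule sum.image_gen) (rule simple_finite_range [OF p])
  also have "\<dots> = (\<Sum>c\<in>\<phi> ` range p. c *\<^sub>C E ((\<lambda>z. \<phi> (p z)) -` {c}) x)"
  proof (rule sum.cong [OF refl])
    fix c
    let ?V = "{v \<in> range p. \<phi> v = c}"
    have "E (\<Union>v\<in>?V. p -` {v}) x = (\<Sum>v\<in>?V. E (p -` {v}) x)"
      by (rule E_UN_finite)
        (auto simp: disjoint_family_on_def simple_finite_range [OF p] simple_vimage [OF p])
    moreover have "(\<Union>v\<in>?V. p -` {v}) = (\<lambda>z. \<phi> (p z)) -` {c}"
      by auto
    ultimately show "(\<Sum>v\<in>?V. \<phi> v *\<^sub>C E (p -` {v}) x) = c *\<^sub>C E ((\<lambda>z. \<phi> (p z)) -` {c}) x"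
      by (simp add: scaleC.sum_right)
  qed
  finally show ?thesis
    by (simp add: simple_spectral_integral_def image_image)
qed

lemma simple_spectral_integral_compose2:
  assumes s: "simple_function borel s" and t: "simple_function borel t"
  shows "simple_spectral_integral E (\<lambda>z. \<phi> (s z) (t z)) x =
    (\<Sum>v\<in>range (\<lambda>z. (s z, t z)). \<phi> (fst v) (snd v) *\<^sub>C E ((\<lambda>z. (s z, t z)) -` {v}) x)"
  using simple_spectral_integral_compose
    [OF simple_function_Pair [OF s t], of "\<lambda>v. \<phi> (fst v) (snd v)" x] by simp

lemma simple_spectral_integral_diff:
  assumes s: "simple_function borel s" and t: "simple_function borel t"
  shows "simple_spectral_integral E (\<lambda>z. s z - t z) x =
    simple_spectral_integral E s x - simple_spectral_integral E t x"
  using simple_spectral_integral_compose2 [OF s t, of "\<lambda>a b. a" x]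
    simple_spectral_integral_compose2 [OF s t, of "\<lambda>a b. b" x]
  by (simp add: simple_spectral_integral_compose2 [OF s t] scaleC.diff_left sum_subtractf)

lemma bounded_clinear_simple_spectral_integral:
  assumes s: "simple_function borel s"
  shows "bounded_clinear (simple_spectral_integral E s)"
proof -
  have "bounded_linear (\<lambda>x. simple_spectral_integral E s x)"
    unfolding simple_spectral_integral_def [abs_def]
    by (intro bounded_linear_sum bounded_linear_compose [OF scaleC.bounded_linear_right]
        bounded_linear_E simple_vimage [OF s])
  moreover have "simple_spectral_integral E s (c *\<^sub>C x) = c *\<^sub>C simple_spectral_integral E s x" for c x
    by (simp add: simple_spectral_integral_def scaleC.sum_right scaleC_scaleC
        bounded_clinear_scaleC [OF bounded_clinear_E [OF simple_vimage [OF s]]] mult.commute)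
  ultimately show ?thesis
    by (simp add: bounded_clinear_def)
qed

lemma simple_spectral_integral_mult:
  assumes s: "simple_function borel s" and t: "simple_function borel t"
  shows "simple_spectral_integral E (\<lambda>z. s z * t z) x =
    simple_spectral_integral E s (simple_spectral_integral E t x)"
proof -
  let ?p = "\<lambda>z. (s z, t z)"
  have "simple_spectral_integral E s (simple_spectral_integral E t x) =
      (\<Sum>a\<in>range s. \<Sum>b\<in>range t. (a * b) *\<^sub>C E (s -` {a} \<inter> t -` {b}) x)"
    unfolding simple_spectral_integral_def
    by (simp add: linear_sum [OF bounded_linear.linear [OF bounded_linear_E [OF simple_vimage [OF s]]]]
        bounded_clinear_scaleC [OF bounded_clinear_E [OF simple_vimage [OF s]]]
        E_Int simple_vimage [OF s] simple_vimage [OF t] scaleC.sum_right scaleC_scaleC)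
  also have "\<dots> = (\<Sum>v\<in>range s \<times> range t. (fst v * snd v) *\<^sub>C E (?p -` {v}) x)"
  proof -
    have "s -` {fst v} \<inter> t -` {snd v} = ?p -` {v}" for v by auto
    then show ?thesis by (simp add: sum.cartesian_product case_prod_unfold)
  qed
  also have "\<dots> = (\<Sum>v\<in>range ?p. (fst v * snd v) *\<^sub>C E (?p -` {v}) x)"
  proof (rule sum.mono_neutral_right)
    show "\<forall>v\<in>range s \<times> range t - range ?p. (fst v * snd v) *\<^sub>C E (?p -` {v}) x = 0"
    proof
      fix v assume "v \<in> range s \<times> range t - range ?p"
      then have "?p -` {v} = {}" by blast
      then show "(fst v * snd v) *\<^sub>C E (?p -` {v}) x = 0" by (simp add: scaleC.zero_right)
    qed
  qed (auto simp: simple_finite_range [OF s] simple_finite_range [OF t])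
  also have "\<dots> = simple_spectral_integral E (\<lambda>z. s z * t z) x"
    by (rule simple_spectral_integral_compose2 [OF s t, symmetric])
  finally show ?thesis by simp
qed

lemma simple_spectral_integral_const: "simple_spectral_integral E (\<lambda>z. c) x = c *\<^sub>C x"
proof -
  have "(\<lambda>z::complex. c) -` {c} = UNIV" by auto
  then show ?thesis by (simp add: simple_spectral_integral_def)
qed

lemma simple_spectral_integral_indicator:
  assumes "\<delta> \<in> sets borel"
  shows "simple_spectral_integral E (indicator \<delta>) x = E \<delta> x"
proof -
  have pre: "(\<lambda>z. z \<in> \<delta>) -` {b} \<in> sets borel" for b
  proof (cases b)
    case True
    then have "(\<lambda>z. z \<in> \<delta>) -` {b} = \<delta>" by auto
    then show ?thesis using assms by simp
  next
    case False
    then have "(\<lambda>z. z \<in> \<delta>) -` {b} = - \<delta>" by auto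
    then show ?thesis using assms by simp
  qed
  have simple: "simple_function borel (\<lambda>z. z \<in> \<delta>)"
    using pre by (auto simp: simple_function_def intro: finite_subset [of _ UNIV])
  have "simple_spectral_integral E (\<lambda>z. if z \<in> \<delta> then 1 else 0) x =
      (\<Sum>b\<in>range (\<lambda>z. z \<in> \<delta>). (if b then 1 else 0) *\<^sub>C E ((\<lambda>z. z \<in> \<delta>) -` {b}) x)"
    by (rule simple_spectral_integral_compose [of "\<lambda>z. z \<in> \<delta>" "\<lambda>b. if b then 1 else 0"])
      (use simple in simp)
  also have "\<dots> = (\<Sum>b\<in>UNIV. (if b then 1 else 0) *\<^sub>C E ((\<lambda>z. z \<in> \<delta>) -` {b}) x)"
  proof (rule sum.mono_neutral_left)
    show "\<forall>b\<in>UNIV - range (\<lambda>z. z \<in> \<delta>). (if b then 1 else 0) *\<^sub>C E ((\<lambda>z. z \<in> \<delta>) -` {b}) x = 0"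
    proof
      fix b assume "b \<in> UNIV - range (\<lambda>z. z \<in> \<delta>)"
      then have "(\<lambda>z. z \<in> \<delta>) -` {b} = {}" by blast
      then show "(if b then 1 else 0) *\<^sub>C E ((\<lambda>z. z \<in> \<delta>) -` {b}) x = 0"
        by (simp add: scaleC.zero_right)
    qed
  qed auto
  also have "\<dots> = E \<delta> x"
    by (simp add: UNIV_bool scaleC.zero_left vimage_def)
  finally show ?thesis
    by (simp add: indicator_def [abs_def] of_bool_def)
qed

lemma norm_simple_spectral_integral_le:
  assumes s: "simple_function borel s" and le: "\<And>z. cmod (s z) \<le> B"
  shows "norm (simple_spectral_integral E s x) \<le> 4 * spectral_bound * B * norm x"
proof -
  have "norm (\<Sum>c\<in>range s. c *\<^sub>C E (s -` {c}) x) \<le> 4 * (spectral_bound * norm x) * B"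
  proof (rule norm_sum_scaleC_le)
    fix S assume S: "S \<subseteq> range s"
    have "(\<Sum>c\<in>S. E (s -` {c}) x) = E (\<Union>c\<in>S. s -` {c}) x"
      by (rule E_UN_finite [symmetric])
        (use S simple_finite_range [OF s] simple_vimage [OF s] finite_subset
          in \<open>auto simp: disjoint_family_on_def\<close>)
    also have "norm \<dots> \<le> spectral_bound * norm x"
      by (rule norm_E_le) (use simple_vimage [OF s, of S] in \<open>simp add: vimage_eq_UN [symmetric]\<close>)
    finally show "norm (\<Sum>c\<in>S. E (s -` {c}) x) \<le> spectral_bound * norm x" .
  next
    show "0 \<le> B" using le [of 0] norm_ge_zero order_trans by blast
  qed (use le simple_finite_range [OF s] in auto)
  then show ?thesis
    by (simp add: simple_spectral_integral_def algebra_simps)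
qed

end

section \<open>The functional calculus for bounded Borel functions\<close>

definition bounded_borel :: "(complex \<Rightarrow> complex) \<Rightarrow> bool" where
  "bounded_borel F \<longleftrightarrow> F \<in> borel_measurable borel \<and> bounded (range F)"

lemma bounded_borelI:
  "F \<in> borel_measurable borel \<Longrightarrow> (\<And>z. cmod (F z) \<le> B) \<Longrightarrow> bounded_borel F"
  by (auto simp: bounded_borel_def bounded_iff)

lemma bounded_borelE:
  assumes "bounded_borel F"
  obtains B where "B > 0" "\<And>z. cmod (F z) \<le> B"
  using assms by (auto simp: bounded_borel_def bounded_pos)

lemma bounded_borel_const [simp]: "bounded_borel (\<lambda>z. c)"
  by (rule bounded_borelI [of _ "cmod c"]) auto

lemma bounded_borel_indicator: "\<delta> \<in> sets borel \<Longrightarrow> bounded_borel (indicator \<delta>)"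
  by (rule bounded_borelI [of _ 1]) (auto simp: indicator_def)

lemma bounded_borel_mult:
  assumes "bounded_borel F" "bounded_borel G"
  shows "bounded_borel (\<lambda>z. F z * G z)"
proof -
  obtain B C where "B > 0" "\<And>z. cmod (F z) \<le> B" "C > 0" "\<And>z. cmod (G z) \<le> C"
    using assms by (meson bounded_borelE)
  then show ?thesis
    using assms
    by (intro bounded_borelI [of _ "B * C"])
      (auto simp: bounded_borel_def norm_mult intro!: mult_mono)
qed

lemma bounded_borel_diff:
  assumes "bounded_borel F" "bounded_borel G"
  shows "bounded_borel (\<lambda>z. F z - G z)"
proof -
  obtain B C where "\<And>z. cmod (F z) \<le> B" "\<And>z. cmod (G z) \<le> C"
    using assms by (meson bounded_borelE)
  then show ?thesis
    using assms
    by (intro bounded_borelI [of _ "B + C"])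
      (auto simp: bounded_borel_def intro!: norm_triangle_le_diff add_mono)
qed

text \<open>Rounding real and imaginary part down to a multiple of \<open>1 / (2 (n + 1))\<close> leaves only finitely
  many values, because \<open>F\<close> is bounded.\<close>

lemma bounded_borel_uniform_simple_approximation:
  assumes F: "bounded_borel F"
  shows "\<exists>s. \<forall>n. simple_function borel (s n) \<and> (\<forall>z. cmod (s n z - F z) \<le> inverse (real (Suc n)))"
proof -
  obtain B where B: "\<And>z. cmod (F z) \<le> B"
    using F bounded_borelE by blast
  have [measurable]: "F \<in> borel_measurable borel"
    using F by (simp add: bounded_borel_def)
  define m where "m n = 2 * real (Suc n)" for n
  have m: "m n > 0" for n by (simp add: m_def)
  define g where "g n x = real_of_int \<lfloor>m n * x\<rfloor> / m n" for n x
  have g: "\<bar>g n x - x\<bar> \<le> inverse (m n)" for n x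
  proof -
    have "\<bar>real_of_int \<lfloor>m n * x\<rfloor> - m n * x\<bar> \<le> 1" by linarith
    then have "\<bar>real_of_int \<lfloor>m n * x\<rfloor> - m n * x\<bar> / m n \<le> 1 / m n"
      using m [of n] by (intro divide_right_mono) auto
    moreover have "\<bar>g n x - x\<bar> = \<bar>real_of_int \<lfloor>m n * x\<rfloor> - m n * x\<bar> / m n"
      using m [of n] by (simp add: g_def field_simps abs_divide [symmetric] abs_if)
    ultimately show ?thesis by (simp add: inverse_eq_divide)
  qed
  define s where "s n z = Complex (g n (Re (F z))) (g n (Im (F z)))" for n z
  show ?thesis
  proof (intro exI allI conjI)
    fix n
    define I where "I = real_of_int ` {\<lfloor>- (m n * B)\<rfloor>..\<lfloor>m n * B\<rfloor>}"
    have "g n x \<in> (\<lambda>a. a / m n) ` I" if "\<bar>x\<bar> \<le> B" for x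
    proof -
      have "m n * x \<le> m n * B" "m n * (- B) \<le> m n * x"
        using that m [of n] by (intro mult_left_mono; simp add: abs_le_iff)+
      then show ?thesis
        unfolding g_def I_def by (intro imageI) (simp add: floor_mono)
    qed
    then have "s n z \<in> (\<lambda>(a, b). Complex a b) ` (((\<lambda>a. a / m n) ` I) \<times> ((\<lambda>a. a / m n) ` I))" for z
      using order_trans [OF abs_Re_le_cmod B] order_trans [OF abs_Im_le_cmod B]
      unfolding s_def by (intro rev_image_eqI [where x = "(g n (Re (F z)), g n (Im (F z)))"]) auto
    then have "range (s n) \<subseteq> (\<lambda>(a, b). Complex a b) ` (((\<lambda>a. a / m n) ` I) \<times> ((\<lambda>a. a / m n) ` I))"
      by blast
    then have "finite (range (s n))"
      by (rule finite_subset) (simp add: I_def)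
    moreover have "s n \<in> borel_measurable borel"
      unfolding s_def g_def Complex_eq by measurable
    ultimately show "simple_function borel (s n)"
      by (intro simple_function_borel_measurable) auto
  next
    fix n z
    have "cmod (s n z - F z) \<le> \<bar>g n (Re (F z)) - Re (F z)\<bar> + \<bar>g n (Im (F z)) - Im (F z)\<bar>"
      using cmod_le [of "s n z - F z"] by (simp add: s_def)
    also have "\<dots> \<le> inverse (m n) + inverse (m n)"
      by (intro add_mono g)
    also have "\<dots> = inverse (real (Suc n))"
      by (simp add: m_def field_simps)
    finally show "cmod (s n z - F z) \<le> inverse (real (Suc n))" .
  qed
qed

lemma tendsto_mult_inverse_Suc: "(\<lambda>n. c * inverse (real (Suc n)) * d) \<longlonglongrightarrow> 0"
  using tendsto_mult [OF tendsto_mult [OF tendsto_const LIMSEQ_inverse_real_of_nat] tendsto_const]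
  by (auto intro: tendsto_eq_intros)

context spectral_measure_on_complex
begin

abbreviation calculus ("\<Phi>") where "\<Phi> \<equiv> spectral_integral E"

abbreviation simple_integral ("\<Psi>") where "\<Psi> \<equiv> simple_spectral_integral E"

lemma norm_simple_integral_diff_le:
  assumes "simple_function borel s" "simple_function borel t"
    and "\<And>z. cmod (s z - F z) \<le> \<epsilon>" "\<And>z. cmod (t z - F z) \<le> \<eta>"
  shows "norm (\<Psi> s x - \<Psi> t x) \<le> 4 * spectral_bound * (\<epsilon> + \<eta>) * norm x"
proof -
  have "cmod (s z - t z) \<le> \<epsilon> + \<eta>" for z
    using norm_triangle_le_diff [of "s z - F z" "t z - F z" "\<epsilon> + \<eta>"] add_mono [OF assms(3,4), of z]
    by simp
  then show ?thesis
    unfolding simple_spectral_integral_diff [OF assms(1,2), symmetric]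
    by (intro norm_simple_spectral_integral_le simple_function_diff assms(1,2))
qed

text \<open>The limit of the integrals along one approximating sequence is compared with the integral of
  an arbitrary simple function, which makes the limit independent of the sequence.\<close>

lemma exists_calculus:
  assumes F: "bounded_borel F"
  shows "\<exists>T. bounded_clinear T \<and>
    (\<forall>s \<epsilon> x. simple_function borel s \<longrightarrow> (\<forall>z. cmod (s z - F z) \<le> \<epsilon>) \<longrightarrow>
       norm (\<Psi> s x - T x) \<le> 4 * spectral_bound * \<epsilon> * norm x)"
proof -
  let ?M = "spectral_bound"
  obtain s where s: "\<And>n. simple_function borel (s n)"
    and sF: "\<And>n z. cmod (s n z - F z) \<le> inverse (real (Suc n))"
    using bounded_borel_uniform_simple_approximation [OF F] by metis
  note M0 = spectral_bound_nonneg
  have "Cauchy (\<lambda>n. \<Psi> (s n) x)" for x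
  proof (rule metric_CauchyI)
    fix e :: real assume e: "0 < e"
    have "\<forall>\<^sub>F n in sequentially. 8 * ?M * inverse (real (Suc n)) * norm x < e"
      by (rule order_tendstoD(2) [OF tendsto_mult_inverse_Suc e])
    then obtain N where N: "8 * ?M * inverse (real (Suc N)) * norm x < e"
      unfolding eventually_sequentially by blast
    have "dist (\<Psi> (s m) x) (\<Psi> (s n) x) < e" if "m \<ge> N" "n \<ge> N" for m n
    proof -
      have "norm (\<Psi> (s m) x - \<Psi> (s n) x) \<le>
          4 * ?M * (inverse (real (Suc m)) + inverse (real (Suc n))) * norm x"
        by (rule norm_simple_integral_diff_le [OF s s sF sF])
      also have "\<dots> \<le> 4 * ?M * (inverse (real (Suc N)) + inverse (real (Suc N))) * norm x"
        using that M0 by (intro mult_right_mono mult_left_mono add_mono le_imp_inverse_le) auto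
      also have "\<dots> < e" using N by (simp add: algebra_simps)
      finally show ?thesis by (simp add: dist_norm)
    qed
    then show "\<exists>N. \<forall>m\<ge>N. \<forall>n\<ge>N. dist (\<Psi> (s m) x) (\<Psi> (s n) x) < e" by blast
  qed
  then have conv: "convergent (\<lambda>n. \<Psi> (s n) x)" for x
    by (simp add: Cauchy_convergent_iff)
  define T where "T x = lim (\<lambda>n. \<Psi> (s n) x)" for x
  have T: "(\<lambda>n. \<Psi> (s n) x) \<longlonglongrightarrow> T x" for x
    using conv by (simp add: T_def convergent_LIMSEQ_iff)
  have approx: "norm (\<Psi> t x - T x) \<le> 4 * ?M * \<epsilon> * norm x"
    if t: "simple_function borel t" and tF: "\<And>z. cmod (t z - F z) \<le> \<epsilon>" for t \<epsilon> x
  proof (rule LIMSEQ_le)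
    show "(\<lambda>n. norm (\<Psi> t x - \<Psi> (s n) x)) \<longlonglongrightarrow> norm (\<Psi> t x - T x)"
      by (intro tendsto_intros T)
    have "(\<lambda>n. 4 * ?M * (\<epsilon> + inverse (real (Suc n))) * norm x) \<longlonglongrightarrow> 4 * ?M * (\<epsilon> + 0) * norm x"
      by (intro tendsto_mult tendsto_add tendsto_const LIMSEQ_inverse_real_of_nat)
    then show "(\<lambda>n. 4 * ?M * (\<epsilon> + inverse (real (Suc n))) * norm x) \<longlonglongrightarrow> 4 * ?M * \<epsilon> * norm x"
      by simp
    show "\<exists>N. \<forall>n\<ge>N. norm (\<Psi> t x - \<Psi> (s n) x) \<le> 4 * ?M * (\<epsilon> + inverse (real (Suc n))) * norm x"
      using norm_simple_integral_diff_le [OF t s tF sF] by blast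
  qed
  note S = bounded_clinear_simple_spectral_integral [OF s]
  note Sl = bounded_clinear_imp_bounded_linear [OF S]
  have add: "T (x + y) = T x + T y" for x y
    by (rule LIMSEQ_unique [OF T]) (use tendsto_add [OF T T] in \<open>simp add: bounded_linear.linear linear_add Sl\<close>)
  have scale: "T (c *\<^sub>C x) = c *\<^sub>C T x" for c x
    by (rule LIMSEQ_unique [OF T])
      (use scaleC.tendsto [OF tendsto_const T] in \<open>simp add: bounded_clinear_scaleC [OF S]\<close>)
  have scaleR: "T (r *\<^sub>R x) = r *\<^sub>R T x" for r x
    using scale [of "complex_of_real r" x] by (simp add: scaleC_of_real)
  obtain K where K: "\<And>x. norm (\<Psi> (s 0) x) \<le> norm x * K"
    using bounded_linear.bounded [OF Sl] by blast
  have "norm (T x) \<le> norm x * (K + 4 * ?M)" for x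
  proof -
    have "norm (\<Psi> (s 0) x - T x) \<le> 4 * ?M * 1 * norm x"
      using sF [of 0] by (intro approx s) auto
    then show ?thesis
      using K [of x] norm_triangle_ineq2 [of "T x" "\<Psi> (s 0) x"]
      by (simp add: norm_minus_commute algebra_simps)
  qed
  then have "bounded_linear T"
    by (rule bounded_linear_intro [OF add scaleR])
  then have "bounded_clinear T"
    using scale by (simp add: bounded_clinear_def)
  with approx show ?thesis
    by blast
qed

text \<open>The estimate against simple functions is what makes the operator satisfy the description by
  which \<open>spectral_integral\<close> is defined; the description determines the operator because already one
  uniformly approximating sequence does. All later facts follow from this estimate.\<close>

lemma calculus_properties:
  assumes F: "bounded_borel F"
  shows bounded_clinear_calculus: "bounded_clinear (\<Phi> F)"
    and norm_simple_integral_diff_calculus_le: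
      "\<And>s \<epsilon> x. simple_function borel s \<Longrightarrow> (\<And>z. cmod (s z - F z) \<le> \<epsilon>) \<Longrightarrow>
         norm (\<Psi> s x - \<Phi> F x) \<le> 4 * spectral_bound * \<epsilon> * norm x"
proof -
  let ?M = "spectral_bound"
  note M0 = spectral_bound_nonneg
  obtain T where T: "bounded_clinear T"
    and approx: "\<And>s \<epsilon> x. simple_function borel s \<Longrightarrow> (\<And>z. cmod (s z - F z) \<le> \<epsilon>) \<Longrightarrow>
           norm (\<Psi> s x - T x) \<le> 4 * ?M * \<epsilon> * norm x"
    using exists_calculus [OF F] by metis
  have "\<Phi> F = T"
    unfolding spectral_integral_def
  proof (rule the_equality)
    show "bounded_clinear T \<and>
        (\<forall>s. (\<forall>n. simple_function borel (s n)) \<and> uniform_limit UNIV s F sequentially \<longrightarrow>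
             (\<lambda>n. onorm (\<lambda>x. \<Psi> (s n) x - T x)) \<longlonglongrightarrow> 0)"
    proof (intro conjI T allI impI)
      fix s :: "nat \<Rightarrow> complex \<Rightarrow> complex"
      assume s: "(\<forall>n. simple_function borel (s n)) \<and> uniform_limit UNIV s F sequentially"
      show "(\<lambda>n. onorm (\<lambda>x. \<Psi> (s n) x - T x)) \<longlonglongrightarrow> 0"
      proof (rule tendstoI)
        fix e :: real assume e: "0 < e"
        \<comment> \<open>The summand 1 keeps the denominator positive when \<open>?M = 0\<close>, which may happen
          on the zero space.\<close>
        define d where "d = e / (4 * ?M + 1)"
        have d: "d > 0" using e M0 by (simp add: d_def)
        have "4 * ?M * d < (4 * ?M + 1) * d"
          using d by (simp add: algebra_simps)
        also have "\<dots> = e" using M0 by (simp add: d_def)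
        finally have de: "4 * ?M * d < e" .
        have "\<forall>\<^sub>F n in sequentially. \<forall>z\<in>UNIV. dist (s n z) (F z) < d"
          using s d by (auto simp: uniform_limit_iff)
        then show "\<forall>\<^sub>F n in sequentially. dist (onorm (\<lambda>x. \<Psi> (s n) x - T x)) 0 < e"
        proof eventually_elim
          case (elim n)
          have "norm (\<Psi> (s n) x - T x) \<le> 4 * ?M * d * norm x" for x
            using s elim by (intro approx) (auto simp: dist_norm less_imp_le)
          then have "onorm (\<lambda>x. \<Psi> (s n) x - T x) \<le> 4 * ?M * d"
            using M0 d by (intro onorm_bound) auto
          moreover have "0 \<le> onorm (\<lambda>x. \<Psi> (s n) x - T x)"
            using s T by (intro onorm_pos_le bounded_linear_sub bounded_clinear_imp_bounded_linear
                bounded_clinear_simple_spectral_integral) auto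
          ultimately show ?case using de by simp
        qed
      qed
    qed
  next
    fix T' assume T': "bounded_clinear T' \<and>
        (\<forall>s. (\<forall>n. simple_function borel (s n)) \<and> uniform_limit UNIV s F sequentially \<longrightarrow>
             (\<lambda>n. onorm (\<lambda>x. \<Psi> (s n) x - T' x)) \<longlonglongrightarrow> 0)"
    obtain s where s: "\<And>n. simple_function borel (s n)"
      and sF: "\<And>n z. cmod (s n z - F z) \<le> inverse (real (Suc n))"
      using bounded_borel_uniform_simple_approximation [OF F] by metis
    have "uniform_limit UNIV s F sequentially"
      unfolding uniform_limit_iff
    proof (intro allI impI)
      fix e :: real assume "0 < e"
      then have "\<forall>\<^sub>F n in sequentially. inverse (real (Suc n)) < e"
        by (rule order_tendstoD(2) [OF LIMSEQ_inverse_real_of_nat])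
      then show "\<forall>\<^sub>F n in sequentially. \<forall>z\<in>UNIV. dist (s n z) (F z) < e"
        by eventually_elim (auto simp: dist_norm intro: order_le_less_trans [OF sF])
    qed
    then have lim: "(\<lambda>n. onorm (\<lambda>x. \<Psi> (s n) x - T' x)) \<longlonglongrightarrow> 0"
      using T' s by blast
    show "T' = T"
    proof
      fix x
      have "norm (T x - T' x) \<le> 0"
      proof (rule LIMSEQ_le_const)
        show "(\<lambda>n. 4 * ?M * inverse (real (Suc n)) * norm x +
            onorm (\<lambda>x. \<Psi> (s n) x - T' x) * norm x) \<longlonglongrightarrow> 0"
          using tendsto_add [OF tendsto_mult_inverse_Suc tendsto_mult_left_zero [OF lim]]
          by simp
        have "norm (T x - T' x) \<le> 4 * ?M * inverse (real (Suc n)) * norm x +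
            onorm (\<lambda>x. \<Psi> (s n) x - T' x) * norm x" for n
        proof -
          have "norm (T x - T' x) \<le> norm (\<Psi> (s n) x - T x) + norm (\<Psi> (s n) x - T' x)"
            using norm_triangle_ineq4 [of "\<Psi> (s n) x - T' x" "\<Psi> (s n) x - T x"] by simp
          moreover have "norm (\<Psi> (s n) x - T' x) \<le> onorm (\<lambda>x. \<Psi> (s n) x - T' x) * norm x"
            using s T' by (intro onorm bounded_linear_sub bounded_clinear_imp_bounded_linear
                bounded_clinear_simple_spectral_integral) auto
          moreover have "norm (\<Psi> (s n) x - T x) \<le> 4 * ?M * inverse (real (Suc n)) * norm x"
            by (intro approx s sF)
          ultimately show ?thesis by linarith
        qed
        then show "\<exists>N. \<forall>n\<ge>N. norm (T x - T' x) \<le> 4 * ?M * inverse (real (Suc n)) * norm x +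
            onorm (\<lambda>x. \<Psi> (s n) x - T' x) * norm x" by blast
      qed
      then show "T' x = T x" by simp
    qed
  qed
  with T approx show "bounded_clinear (\<Phi> F)"
    "\<And>s \<epsilon> x. simple_function borel s \<Longrightarrow> (\<And>z. cmod (s z - F z) \<le> \<epsilon>) \<Longrightarrow>
         norm (\<Psi> s x - \<Phi> F x) \<le> 4 * ?M * \<epsilon> * norm x"
    by auto
qed

lemma norm_calculus_le:
  assumes "bounded_borel F" "\<And>z. cmod (F z) \<le> B"
  shows "norm (\<Phi> F x) \<le> 4 * spectral_bound * B * norm x"
  using norm_simple_integral_diff_calculus_le [OF assms(1), of "\<lambda>z. 0" B x] assms(2)
  by (simp add: simple_spectral_integral_const scaleC.zero_left)

lemma calculus_eq_simple_integral:
  assumes s: "simple_function borel s"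
  shows "\<Phi> s x = \<Psi> s x"
proof -
  have "bounded_borel s"
    using s borel_measurable_simple_function [OF s] simple_finite_range [OF s]
    by (simp add: bounded_borel_def finite_imp_bounded)
  from norm_simple_integral_diff_calculus_le [OF this s, of 0 x] show ?thesis
    by simp
qed

lemma calculus_const: "\<Phi> (\<lambda>z. c) x = c *\<^sub>C x"
  by (simp add: calculus_eq_simple_integral simple_spectral_integral_const)

lemma calculus_indicator: "\<delta> \<in> sets borel \<Longrightarrow> \<Phi> (indicator \<delta>) x = E \<delta> x"
  by (simp add: calculus_eq_simple_integral simple_spectral_integral_indicator)

lemma simple_integral_tendsto_calculus:
  assumes F: "bounded_borel F" and s: "\<And>n. simple_function borel (s n)"
    and le: "\<And>n z. cmod (s n z - F z) \<le> C * inverse (real (Suc n))"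
  shows "(\<lambda>n. \<Psi> (s n) x) \<longlonglongrightarrow> \<Phi> F x"
proof (rule LIM_zero_cancel, rule Lim_null_comparison)
  show "\<forall>\<^sub>F n in sequentially. norm (\<Psi> (s n) x - \<Phi> F x) \<le>
      (4 * spectral_bound * C) * inverse (real (Suc n)) * norm x"
    using norm_simple_integral_diff_calculus_le [OF F s le]
    by (intro always_eventually) (simp add: mult.assoc)
qed (rule tendsto_mult_inverse_Suc)

lemma calculus_diff:
  assumes F: "bounded_borel F" and G: "bounded_borel G"
  shows "\<Phi> (\<lambda>z. F z - G z) x = \<Phi> F x - \<Phi> G x"
proof -
  obtain s where s: "\<And>n. simple_function borel (s n)"
    and sF: "\<And>n z. cmod (s n z - F z) \<le> inverse (real (Suc n))"
    using bounded_borel_uniform_simple_approximation [OF F] by metis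
  obtain t where t: "\<And>n. simple_function borel (t n)"
    and tG: "\<And>n z. cmod (t n z - G z) \<le> inverse (real (Suc n))"
    using bounded_borel_uniform_simple_approximation [OF G] by metis
  have "(\<lambda>n. \<Psi> (\<lambda>z. s n z - t n z) x) \<longlonglongrightarrow> \<Phi> (\<lambda>z. F z - G z) x"
  proof (rule simple_integral_tendsto_calculus)
    fix n z
    show "cmod ((s n z - t n z) - (F z - G z)) \<le> 2 * inverse (real (Suc n))"
      using norm_triangle_ineq4 [of "s n z - F z" "t n z - G z"] sF [of n z] tG [of n z]
      by (simp add: algebra_simps)
  qed (intro bounded_borel_diff simple_function_diff F G s t)+
  moreover have "(\<lambda>n. \<Psi> (s n) x - \<Psi> (t n) x) \<longlonglongrightarrow> \<Phi> F x - \<Phi> G x"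
    by (intro tendsto_diff simple_integral_tendsto_calculus [where C = 1] F G s t)
      (use sF tG in auto)
  ultimately show ?thesis
    using LIMSEQ_unique by (simp add: simple_spectral_integral_diff [OF s t])
qed

text \<open>Multiplicativity passes from simple functions to their uniform limits since the approximants
  are uniformly bounded.\<close>

lemma calculus_mult:
  assumes F: "bounded_borel F" and G: "bounded_borel G"
  shows "\<Phi> (\<lambda>z. F z * G z) x = \<Phi> F (\<Phi> G x)"
proof -
  let ?M = "spectral_bound"
  note M0 = spectral_bound_nonneg
  obtain s where s: "\<And>n. simple_function borel (s n)"
    and sF: "\<And>n z. cmod (s n z - F z) \<le> inverse (real (Suc n))"
    using bounded_borel_uniform_simple_approximation [OF F] by metis
  obtain t where t: "\<And>n. simple_function borel (t n)"
    and tG: "\<And>n z. cmod (t n z - G z) \<le> inverse (real (Suc n))"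
    using bounded_borel_uniform_simple_approximation [OF G] by metis
  obtain B where B: "B > 0" "\<And>z. cmod (F z) \<le> B" using F bounded_borelE by blast
  obtain C where C: "C > 0" "\<And>z. cmod (G z) \<le> C" using G bounded_borelE by blast
  have sB: "cmod (s n z) \<le> B + 1" for n z
  proof -
    have "inverse (real (Suc n)) \<le> 1" by (simp add: field_simps)
    then show ?thesis
      using sF [of n z] B(2) [of z] norm_triangle_ineq2 [of "s n z" "F z"] by linarith
  qed
  have "(\<lambda>n. \<Psi> (\<lambda>z. s n z * t n z) x) \<longlonglongrightarrow> \<Phi> (\<lambda>z. F z * G z) x"
  proof (rule simple_integral_tendsto_calculus)
    fix n z
    have "s n z * t n z - F z * G z = s n z * (t n z - G z) + (s n z - F z) * G z"
      by (simp add: algebra_simps)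
    also have "cmod \<dots> \<le> (B + 1) * inverse (real (Suc n)) + inverse (real (Suc n)) * C"
      using sB sF tG C B(1)
      by (intro norm_triangle_le add_mono) (auto simp: norm_mult intro!: mult_mono)
    finally show "cmod (s n z * t n z - F z * G z) \<le> (B + 1 + C) * inverse (real (Suc n))"
      by (simp add: algebra_simps)
  qed (intro bounded_borel_mult simple_function_mult F G s t)+
  moreover have "(\<lambda>n. \<Psi> (s n) (\<Psi> (t n) x)) \<longlonglongrightarrow> \<Phi> F (\<Phi> G x)"
  proof (rule LIM_zero_cancel, rule Lim_null_comparison)
    show "\<forall>\<^sub>F n in sequentially. norm (\<Psi> (s n) (\<Psi> (t n) x) - \<Phi> F (\<Phi> G x)) \<le>
        (4 * ?M * (B + 1) * (4 * ?M)) * inverse (real (Suc n)) * norm x +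
        (4 * ?M) * inverse (real (Suc n)) * norm (\<Phi> G x)"
    proof (intro always_eventually allI)
      fix n
      let ?u = "\<Psi> (t n) x - \<Phi> G x"
      have "\<Psi> (s n) (\<Psi> (t n) x) - \<Phi> F (\<Phi> G x) =
          \<Psi> (s n) ?u + (\<Psi> (s n) (\<Phi> G x) - \<Phi> F (\<Phi> G x))"
        by (simp add: bounded_linear.linear linear_diff
            bounded_clinear_imp_bounded_linear bounded_clinear_simple_spectral_integral s)
      also have "norm \<dots> \<le> 4 * ?M * (B + 1) * norm ?u + 4 * ?M * inverse (real (Suc n)) * norm (\<Phi> G x)"
        using sB sF
        by (intro norm_triangle_le add_mono norm_simple_spectral_integral_le
            norm_simple_integral_diff_calculus_le F s) auto
      also have "norm ?u \<le> 4 * ?M * inverse (real (Suc n)) * norm x"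
        by (intro norm_simple_integral_diff_calculus_le G t tG)
      finally show "norm (\<Psi> (s n) (\<Psi> (t n) x) - \<Phi> F (\<Phi> G x)) \<le>
        (4 * ?M * (B + 1) * (4 * ?M)) * inverse (real (Suc n)) * norm x +
        (4 * ?M) * inverse (real (Suc n)) * norm (\<Phi> G x)"
        using M0 B by (simp add: mult.assoc mult_left_mono)
    qed
    show "(\<lambda>n. (4 * ?M * (B + 1) * (4 * ?M)) * inverse (real (Suc n)) * norm x +
        (4 * ?M) * inverse (real (Suc n)) * norm (\<Phi> G x)) \<longlonglongrightarrow> 0"
      using tendsto_add [OF tendsto_mult_inverse_Suc tendsto_mult_inverse_Suc] by simp
  qed
  ultimately show ?thesis
    using LIMSEQ_unique by (simp add: simple_spectral_integral_mult [OF s t])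
qed

lemma calculus_scaleC:
  assumes F: "bounded_borel F"
  shows "\<Phi> (\<lambda>z. c * F z) x = c *\<^sub>C \<Phi> F x"
  using calculus_mult [OF bounded_borel_const F, of c x] by (simp add: calculus_const)

lemma E_calculus:
  assumes "bounded_borel F" "\<delta> \<in> sets borel"
  shows "E \<delta> (\<Phi> F x) = \<Phi> (\<lambda>z. indicator \<delta> z * F z) x"
  using calculus_mult [OF bounded_borel_indicator assms(1)] assms(2)
  by (simp add: calculus_indicator)

end

section \<open>Convergence and support of the spectral measure\<close>

context spectral_measure_on_complex
begin

lemma E_null_countable_UN:
  fixes U :: "nat \<Rightarrow> complex set"
  assumes "\<And>n. U n \<in> sets borel" "\<And>n x. E (U n) x = 0"
  shows "E (\<Union>n. U n) x = 0"
proof -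
  have borel: "disjointed U n \<in> sets borel" for n
    using sets.range_disjointed_sets [of U borel] assms(1) by auto
  have "E (disjointed U n) x = 0" for n
    using E_Int [OF borel assms(1), of n n x] assms(2) [of n x] disjointed_subset [of U n]
      linear_0 [OF bounded_linear.linear [OF bounded_linear_E [OF borel]]]
    by (simp add: Int_absorb2)
  moreover have "(\<lambda>n. E (disjointed U n) x) sums E (\<Union>n. disjointed U n) x"
    by (rule E_sums [OF borel disjoint_family_disjointed])
  ultimately show ?thesis
    by (simp add: UN_disjointed_eq sums_iff)
qed

lemma E_LIMSEQ_incseq:
  assumes S: "\<And>n. S n \<in> sets borel" and "incseq S"
  shows "(\<lambda>n. E (S n) x) \<longlonglongrightarrow> E (\<Union>n. S n) x"
proof -
  have borel: "disjointed S n \<in> sets borel" for n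
    using sets.range_disjointed_sets [of S borel] S by auto
  have "(\<lambda>n. E (disjointed S n) x) sums E (\<Union>n. disjointed S n) x"
    by (rule E_sums [OF borel disjoint_family_disjointed])
  then have "(\<lambda>n. \<Sum>i<Suc n. E (disjointed S i) x) \<longlonglongrightarrow> E (\<Union>n. S n) x"
    unfolding sums_def UN_disjointed_eq by (rule LIMSEQ_Suc)
  moreover have "(\<Sum>i<Suc n. E (disjointed S i) x) = E (S n) x" for n
  proof -
    have "(\<Sum>i<Suc n. E (disjointed S i) x) = E (\<Union>i\<in>{0..<Suc n}. disjointed S i) x"
      unfolding lessThan_atLeast0
      by (rule E_UN_finite [symmetric])
        (use borel disjoint_family_disjointed [of S] in \<open>auto simp: disjoint_family_on_def\<close>)
    also have "(\<Union>i\<in>{0..<Suc n}. disjointed S i) = S n"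
      unfolding finite_UN_disjointed_eq using \<open>incseq S\<close> by (fastforce simp: incseq_def less_Suc_eq_le)
    finally show ?thesis .
  qed
  ultimately show ?thesis by simp
qed

text \<open>By Lindelof's theorem countably many of the open sets on which \<open>E\<close> vanishes already cover
  the complement of the support.\<close>

lemma closed_spectral_support: "closed (spectral_support E)"
  and E_outside_support: "E (- spectral_support E) x = 0"
proof -
  define \<U> where "\<U> = {U. open U \<and> (\<forall>x. E U x = 0)}"
  have compl: "- spectral_support E = \<Union>\<U>"
    by (auto simp: spectral_support_def \<U>_def)
  then show "closed (spectral_support E)"
    unfolding closed_def by (auto simp: \<U>_def)
  obtain \<V> where \<V>: "\<V> \<subseteq> \<U>" "countable \<V>" "\<Union>\<V> = \<Union>\<U>"
    by (rule Lindelof [of \<U>]) (auto simp: \<U>_def)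
  show "E (- spectral_support E) x = 0"
  proof (cases "\<V> = {}")
    case True
    then show ?thesis using \<V>(3) compl by (metis Union_empty E_empty)
  next
    case False
    then have range: "range (from_nat_into \<V>) = \<V>"
      using \<V>(2) by (rule range_from_nat_into)
    then have mem: "from_nat_into \<V> n \<in> \<U>" for n
      using \<V>(1) by blast
    have "E (\<Union>n. from_nat_into \<V> n) x = 0"
      by (rule E_null_countable_UN) (use mem in \<open>auto simp: \<U>_def\<close>)
    then show ?thesis
      using compl \<V>(3) range by simp
  qed
qed

lemma E_support [simp]: "E (spectral_support E) x = x"
  using E_split [of UNIV "spectral_support E" x] E_outside_support [of x]
    closed_spectral_support by (simp add: Compl_eq_Diff_UNIV)

text \<open>Bounded parts of the spectrum: after cutting down to one of them the operator becomes bounded,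
  and together they exhaust the identity.\<close>

definition truncation :: "nat \<Rightarrow> complex set" where
  "truncation n = {z \<in> spectral_support E. cmod z \<le> real n}"

lemma truncation_borel [measurable]: "truncation n \<in> sets borel"
proof -
  have "truncation n = spectral_support E \<inter> cball 0 (real n)"
    by (auto simp: truncation_def)
  then show ?thesis
    using closed_spectral_support by (simp add: closed_Int)
qed

lemma truncation_mono: "m \<le> n \<Longrightarrow> truncation m \<subseteq> truncation n"
  by (auto simp: truncation_def)

lemma E_truncation_LIMSEQ: "(\<lambda>n. E (truncation n) x) \<longlonglongrightarrow> x"
proof -
  have "(\<Union>n. truncation n) = spectral_support E"
    using real_nat_ceiling_ge by (force simp: truncation_def)
  then show ?thesis
    using E_LIMSEQ_incseq [of truncation x] by (auto simp: incseq_def dest: truncation_mono)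
qed

lemma eq_if_truncations_eq:
  assumes "\<And>n. E (truncation n) x = E (truncation n) y"
  shows "x = y"
  by (rule LIMSEQ_unique [OF E_truncation_LIMSEQ]) (use E_truncation_LIMSEQ [of y] assms in simp)

end

section \<open>Exponentials\<close>

lemma norm_exp_minus_linear_le: "cmod (exp u - 1 - u) \<le> exp (cmod u) * (cmod u)\<^sup>2"
proof -
  have "cmod (exp u - (\<Sum>k\<le>1. u ^ k / fact k)) \<le> exp \<bar>Re u\<bar> * cmod u ^ Suc 1 / fact 1"
    by (rule Taylor_exp)
  also have "\<dots> \<le> exp (cmod u) * (cmod u)\<^sup>2"
    by (auto simp: power2_eq_square abs_Re_le_cmod intro!: mult_right_mono)
  finally show ?thesis
    by (simp add: algebra_simps)
qed

lemma square_le_exp: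
  assumes "0 < \<epsilon>" "0 \<le> (r::real)"
  shows "r\<^sup>2 \<le> (4 / \<epsilon>)\<^sup>2 * exp (\<epsilon> / 2 * r)"
proof -
  have "\<epsilon> / 4 * r \<le> exp (\<epsilon> / 4 * r)"
    using exp_ge_add_one_self [of "\<epsilon> / 4 * r"] by linarith
  then have "(\<epsilon> / 4 * r)\<^sup>2 \<le> (exp (\<epsilon> / 4 * r))\<^sup>2"
    by (rule power_mono) (use assms in simp)
  also have "\<dots> = exp (\<epsilon> / 2 * r)"
    by (simp add: exp_double [symmetric])
  finally have "(4 / \<epsilon>)\<^sup>2 * (\<epsilon> / 4 * r)\<^sup>2 \<le> (4 / \<epsilon>)\<^sup>2 * exp (\<epsilon> / 2 * r)"
    by (rule mult_left_mono) simp
  moreover have "(4 / \<epsilon>)\<^sup>2 * (\<epsilon> / 4 * r)\<^sup>2 = r\<^sup>2"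
    using assms by (simp add: power_mult_distrib [symmetric])
  ultimately show ?thesis by simp
qed

text \<open>The summand \<open>\<epsilon> \<bar>\<lambda>\<bar>\<close> is room to spare: part of it pays for moving \<open>z\<close> away from \<open>z\<^sub>0\<close>, the rest
  for the powers of \<open>\<lambda>\<close> that appear under differentiation.\<close>

definition exp_weight :: "(complex \<Rightarrow> complex) \<Rightarrow> complex \<Rightarrow> bool" where
  "exp_weight w z0 \<longleftrightarrow> w \<in> borel_measurable borel \<and>
     (\<exists>\<epsilon>>0. \<exists>C. \<forall>l. cmod (w l) * exp (Re (z0 * l) + \<epsilon> * cmod l) \<le> C)"

lemma exp_weightI:
  "w \<in> borel_measurable borel \<Longrightarrow> \<epsilon> > 0 \<Longrightarrow>
    (\<And>l. cmod (w l) * exp (Re (z0 * l) + \<epsilon> * cmod l) \<le> C) \<Longrightarrow> exp_weight w z0"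
  by (auto simp: exp_weight_def)

lemma exp_weight_bounded_borel:
  assumes "exp_weight w z0"
  shows "bounded_borel (\<lambda>l. w l * exp (z0 * l))"
proof -
  obtain \<epsilon> C where eps: "\<epsilon> > 0" and C: "\<And>l. cmod (w l) * exp (Re (z0 * l) + \<epsilon> * cmod l) \<le> C"
    and [measurable]: "w \<in> borel_measurable borel"
    using assms by (auto simp: exp_weight_def)
  show ?thesis
  proof (rule bounded_borelI)
    fix l
    have "cmod (w l * exp (z0 * l)) \<le> cmod (w l) * exp (Re (z0 * l) + \<epsilon> * cmod l)"
      using eps by (simp add: norm_mult mult_left_mono)
    then show "cmod (w l * exp (z0 * l)) \<le> C"
      using C order_trans by blast
  qed measurable
qed

lemma exp_weight_eventually:
  assumes "exp_weight w z0"
  shows "\<forall>\<^sub>F z in at z0. exp_weight w z"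
proof -
  obtain \<epsilon> C where eps: "\<epsilon> > 0" and C: "\<And>l. cmod (w l) * exp (Re (z0 * l) + \<epsilon> * cmod l) \<le> C"
    and w: "w \<in> borel_measurable borel"
    using assms by (auto simp: exp_weight_def)
  have "exp_weight w z" if z: "dist z z0 < \<epsilon> / 2" for z
  proof (rule exp_weightI [OF w, of "\<epsilon> / 2" z C])
    fix l
    have "Re ((z - z0) * l) \<le> cmod (z - z0) * cmod l"
      using complex_Re_le_cmod [of "(z - z0) * l"] by (simp add: norm_mult)
    also have "\<dots> \<le> \<epsilon> / 2 * cmod l"
      using z by (intro mult_right_mono) (auto simp: dist_norm)
    finally have "Re (z * l) + \<epsilon> / 2 * cmod l \<le> Re (z0 * l) + \<epsilon> * cmod l"
      by (simp add: left_diff_distrib)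
    then have "cmod (w l) * exp (Re (z * l) + \<epsilon> / 2 * cmod l) \<le>
        cmod (w l) * exp (Re (z0 * l) + \<epsilon> * cmod l)"
      by (intro mult_left_mono) auto
    then show "cmod (w l) * exp (Re (z * l) + \<epsilon> / 2 * cmod l) \<le> C"
      using C order_trans by blast
  qed (use eps in simp)
  then show ?thesis
    using eps unfolding eventually_at by (intro exI [of _ "\<epsilon> / 2"]) auto
qed

lemma exp_weight_mult_id:
  assumes "exp_weight w z0"
  shows "exp_weight (\<lambda>l. l * w l) z0"
proof -
  obtain \<epsilon> C where eps: "\<epsilon> > 0" and C: "\<And>l. cmod (w l) * exp (Re (z0 * l) + \<epsilon> * cmod l) \<le> C"
    and [measurable]: "w \<in> borel_measurable borel"
    using assms by (auto simp: exp_weight_def)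
  show ?thesis
  proof (rule exp_weightI)
    fix l
    have "\<epsilon> / 2 * cmod l \<le> exp (\<epsilon> / 2 * cmod l)"
      using exp_ge_add_one_self [of "\<epsilon> / 2 * cmod l"] by linarith
    then have "cmod l \<le> 2 / \<epsilon> * exp (\<epsilon> / 2 * cmod l)"
      using eps by (simp add: field_simps)
    then have "cmod (l * w l) * exp (Re (z0 * l) + \<epsilon> / 2 * cmod l) \<le>
        (2 / \<epsilon> * exp (\<epsilon> / 2 * cmod l) * cmod (w l)) * exp (Re (z0 * l) + \<epsilon> / 2 * cmod l)"
      unfolding norm_mult by (intro mult_right_mono) auto
    also have "\<dots> = 2 / \<epsilon> * (cmod (w l) * exp (Re (z0 * l) + \<epsilon> * cmod l))"
    proof -
      have "exp (Re (z0 * l) + \<epsilon> * cmod l) = exp (\<epsilon> / 2 * cmod l) * exp (Re (z0 * l) + \<epsilon> / 2 * cmod l)"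
        by (simp add: exp_add [symmetric])
      then show ?thesis by (simp only: mult_ac)
    qed
    also have "\<dots> \<le> 2 / \<epsilon> * C"
      using eps C by (intro mult_left_mono) auto
    finally show "cmod (l * w l) * exp (Re (z0 * l) + \<epsilon> / 2 * cmod l) \<le> 2 / \<epsilon> * C" .
  qed (use eps in auto)
qed

lemma exp_weight_bounded_support:
  assumes w: "w \<in> borel_measurable borel" and B: "\<And>l. cmod (w l) \<le> B"
    and supp: "\<And>l. cmod l > R \<Longrightarrow> w l = 0"
  shows "exp_weight w z"
proof (rule exp_weightI [OF w, of 1])
  fix l
  have B0: "B \<ge> 0" using B [of 0] norm_ge_zero order_trans by blast
  show "cmod (w l) * exp (Re (z * l) + 1 * cmod l) \<le> B * exp ((cmod z + 1) * R)"
  proof (cases "cmod l > R")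
    case True
    then show ?thesis using supp B0 by simp
  next
    case False
    have "Re (z * l) + 1 * cmod l \<le> (cmod z + 1) * cmod l"
      using complex_Re_le_cmod [of "z * l"] by (simp add: norm_mult algebra_simps)
    also have "\<dots> \<le> (cmod z + 1) * R"
      using False by (intro mult_left_mono) auto
    finally show ?thesis
      using B B0 by (intro mult_mono) auto
  qed
qed simp

context spectral_measure_on_complex
begin

text \<open>The difference quotients of \<open>z \<mapsto> w(\<lambda>) e\<^bsup>z\<lambda>\<^esup>\<close> converge uniformly in \<open>\<lambda>\<close>, so their integrals
  converge in operator norm.\<close>

lemma calculus_exp_difference_quotient_le:
  assumes w: "exp_weight w z0"
  shows "\<exists>K\<ge>0. \<forall>\<^sub>F z in at z0. \<forall>x.
    norm (inverse (z - z0) *\<^sub>C (\<Phi> (\<lambda>l. w l * exp (z * l)) x - \<Phi> (\<lambda>l. w l * exp (z0 * l)) x)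
      - \<Phi> (\<lambda>l. l * w l * exp (z0 * l)) x) \<le> K * cmod (z - z0) * norm x"
proof -
  obtain \<epsilon> C where eps: "\<epsilon> > 0" and C: "\<And>l. cmod (w l) * exp (Re (z0 * l) + \<epsilon> * cmod l) \<le> C"
    using w by (auto simp: exp_weight_def)
  have C0: "0 \<le> C" using order_trans [OF norm_ge_zero [of "w 0"]] C [of 0] by simp
  define K where "K = (4 / \<epsilon>)\<^sup>2 * C"
  define h where "h z l = w l * exp (z * l)" for z l
  define h' where "h' l = l * w l * exp (z0 * l)" for l
  have bb0: "bounded_borel (h z0)" and bb': "bounded_borel h'"
    using exp_weight_bounded_borel [OF w] exp_weight_bounded_borel [OF exp_weight_mult_id [OF w]]
    by (simp_all add: h_def [abs_def] h'_def [abs_def])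
  have pointwise: "cmod (inverse (z - z0) * (h z l - h z0 l) - h' l) \<le> K * cmod (z - z0)"
    if z: "z \<noteq> z0" "dist z z0 < \<epsilon> / 2" for z l
  proof -
    let ?u = "z - z0"
    have u: "?u \<noteq> 0" "cmod ?u < \<epsilon> / 2" using z by (auto simp: dist_norm)
    have "exp (z * l) = exp (z0 * l) * exp (?u * l)"
      by (simp add: exp_add [symmetric] algebra_simps)
    then have split: "h z l = h z0 l * exp (?u * l)" "h' l = l * h z0 l"
      by (simp_all add: h_def h'_def)
    have "inverse ?u * (h z l - h z0 l) - h' l = inverse ?u * h z0 l * (exp (?u * l) - 1 - ?u * l)"
    proof -
      have "inverse v * (c * b - c) - l * c = inverse v * c * (b - 1 - v * l)" if "v \<noteq> 0" for v b c
        using that by (simp add: field_simps)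
      from this [OF u(1), of "h z0 l" "exp (?u * l)"] show ?thesis
        by (simp only: split)
    qed
    then have "cmod (inverse ?u * (h z l - h z0 l) - h' l) =
        inverse (cmod ?u) * cmod (h z0 l) * cmod (exp (?u * l) - 1 - ?u * l)"
      by (simp add: norm_mult norm_inverse)
    also have "\<dots> \<le> inverse (cmod ?u) * cmod (h z0 l) * (exp (cmod (?u * l)) * (cmod (?u * l))\<^sup>2)"
      by (intro mult_left_mono norm_exp_minus_linear_le) simp
    also have "\<dots> = cmod ?u * (cmod (h z0 l) * exp (cmod ?u * cmod l) * (cmod l)\<^sup>2)"
    proof -
      have "inverse a * b * (exp (a * c) * (a * c)\<^sup>2) = a * (b * exp (a * c) * c\<^sup>2)"
        if "a \<noteq> 0" for a b c :: real
        using that by (simp add: power2_eq_square field_simps)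
      then show ?thesis
        unfolding norm_mult by this (use u(1) in simp)
    qed
    also have "\<dots> \<le> cmod ?u * (cmod (h z0 l) * exp (\<epsilon> / 2 * cmod l) * (cmod l)\<^sup>2)"
    proof -
      have "cmod ?u * cmod l \<le> \<epsilon> / 2 * cmod l"
        using u by (intro mult_right_mono) auto
      then show ?thesis
        by (intro mult_left_mono mult_right_mono) auto
    qed
    also have "\<dots> \<le> cmod ?u * (cmod (h z0 l) * exp (\<epsilon> / 2 * cmod l) * ((4 / \<epsilon>)\<^sup>2 * exp (\<epsilon> / 2 * cmod l)))"
      by (intro mult_left_mono square_le_exp eps) auto
    also have "\<dots> = cmod ?u * ((4 / \<epsilon>)\<^sup>2 * (cmod (w l) * exp (Re (z0 * l) + \<epsilon> * cmod l)))"
    proof -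
      have "exp (Re (z0 * l) + \<epsilon> * cmod l) =
          exp (Re (z0 * l)) * exp (\<epsilon> / 2 * cmod l) * exp (\<epsilon> / 2 * cmod l)"
        by (simp add: exp_add [symmetric])
      then show ?thesis by (simp only: h_def norm_mult norm_exp_eq_Re mult_ac)
    qed
    also have "\<dots> \<le> cmod ?u * ((4 / \<epsilon>)\<^sup>2 * C)"
      using C by (intro mult_left_mono) auto
    finally show ?thesis by (simp add: K_def mult.commute)
  qed
  have "\<forall>\<^sub>F z in at z0. z \<noteq> z0 \<and> dist z z0 < \<epsilon> / 2"
    using eps by (auto simp: eventually_at intro!: exI [of _ "\<epsilon> / 2"])
  with exp_weight_eventually [OF w]
  have "\<forall>\<^sub>F z in at z0. \<forall>x. norm (inverse (z - z0) *\<^sub>C (\<Phi> (h z) x - \<Phi> (h z0) x) - \<Phi> h' x)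
      \<le> 4 * spectral_bound * K * cmod (z - z0) * norm x"
  proof eventually_elim
    case (elim z)
    have bb: "bounded_borel (h z)"
      using exp_weight_bounded_borel [OF elim(1)] by (simp add: h_def [abs_def])
    note bbd = bounded_borel_diff [OF bb bb0]
    note bbq = bounded_borel_mult [OF bounded_borel_const [of "inverse (z - z0)"] bbd]
    have "inverse (z - z0) *\<^sub>C (\<Phi> (h z) x - \<Phi> (h z0) x) - \<Phi> h' x =
        \<Phi> (\<lambda>l. inverse (z - z0) * (h z l - h z0 l) - h' l) x" for x
      by (simp add: calculus_diff [OF bbq bb'] calculus_scaleC [OF bbd] calculus_diff [OF bb bb0])
    then show ?case
      using norm_calculus_le [OF bounded_borel_diff [OF bbq bb'] pointwise [OF conjunct1 [OF elim(2)] conjunct2 [OF elim(2)]]]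
      by (simp add: mult.assoc)
  qed
  then show ?thesis
    unfolding h_def h'_def using spectral_bound_nonneg C0
    by (intro exI [of _ "4 * spectral_bound * K"]) (simp add: K_def)
qed

lemma calculus_exp_has_derivative:
  assumes "exp_weight w z0"
  shows "((\<lambda>z. inverse (z - z0) *\<^sub>C (\<Phi> (\<lambda>l. w l * exp (z * l)) x - \<Phi> (\<lambda>l. w l * exp (z0 * l)) x))
    \<longlongrightarrow> \<Phi> (\<lambda>l. l * w l * exp (z0 * l)) x) (at z0)"
proof -
  obtain K where K: "\<forall>\<^sub>F z in at z0. \<forall>x.
    norm (inverse (z - z0) *\<^sub>C (\<Phi> (\<lambda>l. w l * exp (z * l)) x - \<Phi> (\<lambda>l. w l * exp (z0 * l)) x)
      - \<Phi> (\<lambda>l. l * w l * exp (z0 * l)) x) \<le> K * cmod (z - z0) * norm x"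
    using calculus_exp_difference_quotient_le [OF assms] by blast
  show ?thesis
  proof (rule LIM_zero_cancel, rule Lim_null_comparison)
    show "((\<lambda>z. K * cmod (z - z0) * norm x) \<longlongrightarrow> 0) (at z0)"
      by (auto intro!: tendsto_eq_intros)
  qed (use K in \<open>auto elim: eventually_mono\<close>)
qed

end

section \<open>Derivatives of vector-valued functions\<close>

lemma has_vector_derivative_iff_slope:
  "(f has_vector_derivative D) (at t within S) \<longleftrightarrow>
    ((\<lambda>s. inverse (s - t) *\<^sub>R (f s - f t)) \<longlongrightarrow> D) (at t within S)"
proof -
  have "((\<lambda>s. norm (f s - f t - (s - t) *\<^sub>R D) / norm (s - t)) \<longlongrightarrow> 0) (at t within S) \<longleftrightarrow>
      ((\<lambda>s. norm (inverse (s - t) *\<^sub>R (f s - f t) - D)) \<longlongrightarrow> 0) (at t within S)"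
  proof (rule tendsto_cong)
    have "norm (f s - f t - (s - t) *\<^sub>R D) / norm (s - t) = norm (inverse (s - t) *\<^sub>R (f s - f t) - D)"
      if "s \<noteq> t" for s
    proof -
      have "norm (f s - f t - (s - t) *\<^sub>R D) / norm (s - t) =
          norm (inverse (s - t) *\<^sub>R (f s - f t - (s - t) *\<^sub>R D))"
        by (simp add: divide_inverse mult.commute)
      also have "inverse (s - t) *\<^sub>R (f s - f t - (s - t) *\<^sub>R D) = inverse (s - t) *\<^sub>R (f s - f t) - D"
        using that by (simp add: scaleR_diff_right)
      finally show ?thesis .
    qed
    then show "\<forall>\<^sub>F s in at t within S. norm (f s - f t - (s - t) *\<^sub>R D) / norm (s - t) =
        norm (inverse (s - t) *\<^sub>R (f s - f t) - D)"
      by (auto simp: eventually_at_filter)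
  qed
  then show ?thesis
    by (simp add: has_vector_derivative_def has_derivative_iff_norm bounded_linear_scaleR_left
        tendsto_norm_zero_iff LIM_zero_iff)
qed

lemma filterlim_of_real_at:
  fixes c :: complex
  assumes "c \<noteq> 0"
  shows "filterlim (\<lambda>s. c * complex_of_real s) (at (c * complex_of_real t)) (at t within S)"
  unfolding filterlim_at
  using assms by (auto simp: eventually_at_filter intro!: tendsto_intros)

lemma entire_imp_holomorphic:
  assumes "entire F" "bounded_clinear g"
  shows "(\<lambda>z. g (F z)) holomorphic_on UNIV"
  unfolding holomorphic_on_def
proof
  fix z :: complex
  obtain L where "((\<lambda>w. inverse (w - z) *\<^sub>C (F w - F z)) \<longlongrightarrow> L) (at z)"
    using assms(1) unfolding entire_def by blast
  then have "((\<lambda>w. g (inverse (w - z) *\<^sub>C (F w - F z))) \<longlongrightarrow> g L) (at z)"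
    by (rule bounded_linear.tendsto [OF bounded_clinear_imp_bounded_linear [OF assms(2)]])
  then have "((\<lambda>w. (g (F w) - g (F z)) / (w - z)) \<longlongrightarrow> g L) (at z)"
    by (simp add: bounded_clinear_scaleC [OF assms(2)] scaleC_complex_def divide_inverse mult.commute
        linear_diff [OF bounded_linear.linear [OF bounded_clinear_imp_bounded_linear [OF assms(2)]]])
  then show "(\<lambda>z. g (F z)) field_differentiable at z within UNIV"
    by (auto simp: field_differentiable_def has_field_derivative_iff)
qed

context spectral_measure_on_complex
begin

lemma calculus_exp_has_vector_derivative:
  assumes "exp_weight w (complex_of_real t)"
  shows "((\<lambda>s. \<Phi> (\<lambda>l. w l * exp (complex_of_real s * l)) x) has_vector_derivative
    \<Phi> (\<lambda>l. l * w l * exp (complex_of_real t * l)) x) (at t within S)"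
  unfolding has_vector_derivative_iff_slope
  using filterlim_compose [OF calculus_exp_has_derivative [OF assms]
      filterlim_of_real_at [of 1 t S, simplified]]
  by (simp add: scaleC_of_real [symmetric])

lemma entire_calculus_exp:
  "(\<And>z. exp_weight w z) \<Longrightarrow> entire (\<lambda>z. \<Phi> (\<lambda>l. w l * exp (z * l)) x)"
  unfolding entire_def using calculus_exp_has_derivative by blast

end

section \<open>Scalar type spectral operators\<close>

locale scalar_spectral_operator = spectral_measure_on_complex E
  for E :: "complex set \<Rightarrow> 'a::complex_banach \<Rightarrow> 'a" +
  fixes D :: "'a set" and A :: "'a \<Rightarrow> 'a"
  assumes resolution: "resolution_of_identity D A E"
    and dense: "closure D = UNIV"
begin

lemma support_eq_spectrum: "spectral_support E = spectrum D A"
  using resolution by (simp add: resolution_of_identity_def)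

definition truncated_id :: "nat \<Rightarrow> complex \<Rightarrow> complex" where
  "truncated_id n l = indicator (truncation n) l * l"

lemma bounded_borel_truncated_id: "bounded_borel (truncated_id n)"
proof (rule bounded_borelI)
  show "truncated_id n \<in> borel_measurable borel"
    unfolding truncated_id_def [abs_def] by measurable
  show "cmod (truncated_id n l) \<le> real n" for l
    by (auto simp: truncated_id_def indicator_def truncation_def)
qed

lemma spectral_integral_on_truncation:
  "spectral_integral_on E {z \<in> spectrum D A. cmod z \<le> real n} (\<lambda>z. z) = \<Phi> (truncated_id n)"
proof -
  have "(\<lambda>z. if z \<in> {z \<in> spectrum D A. cmod z \<le> real n} then z else 0) = truncated_id n"
    by (auto simp: truncated_id_def indicator_def truncation_def support_eq_spectrum)
  then show ?thesis by (simp add: spectral_integral_on_def)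
qed

lemma domain_eq: "D = {f. convergent (\<lambda>n. \<Phi> (truncated_id n) f)}"
  and operator_LIMSEQ: "f \<in> D \<Longrightarrow> (\<lambda>n. \<Phi> (truncated_id n) f) \<longlonglongrightarrow> A f"
  using resolution by (auto simp: resolution_of_identity_def Let_def spectral_integral_on_truncation)

text \<open>Cutting down to \<open>{\<bar>\<lambda>\<bar> \<le> n}\<close> makes the sequence that defines \<open>A f\<close> constant from its \<open>n\<close>-th term
  on.\<close>

lemma E_truncation_operator:
  assumes "f \<in> D"
  shows "E (truncation n) (A f) = \<Phi> (truncated_id n) f"
proof -
  have "(\<lambda>m. E (truncation n) (\<Phi> (truncated_id m) f)) \<longlonglongrightarrow> E (truncation n) (A f)"
    by (rule bounded_linear.tendsto [OF bounded_linear_E [OF truncation_borel] operator_LIMSEQ [OF assms]])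
  moreover have "E (truncation n) (\<Phi> (truncated_id m) f) = \<Phi> (truncated_id n) f" if "m \<ge> n" for m
  proof -
    have "(\<lambda>l. indicator (truncation n) l * truncated_id m l) = truncated_id n"
      using subsetD [OF truncation_mono [OF that]]
      by (intro ext) (simp add: truncated_id_def indicator_def)
    then show ?thesis
      by (simp add: E_calculus [OF bounded_borel_truncated_id truncation_borel])
  qed
  then have "(\<lambda>m. E (truncation n) (\<Phi> (truncated_id m) f)) \<longlonglongrightarrow> \<Phi> (truncated_id n) f"
    by (intro tendsto_eventually) (auto simp: eventually_sequentially)
  ultimately show ?thesis
    by (rule LIMSEQ_unique)
qed

text \<open>By multiplicativity the integrals defining \<open>A (\<Phi> h x)\<close> are the truncations of
  \<open>\<Phi> (\<lambda>h) x\<close>, which converge.\<close>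

lemma calculus_in_domain:
  assumes h: "bounded_borel h" and lh: "bounded_borel (\<lambda>l. l * h l)"
  shows "\<Phi> h x \<in> D" and "A (\<Phi> h x) = \<Phi> (\<lambda>l. l * h l) x"
proof -
  have "\<Phi> (truncated_id n) (\<Phi> h x) = E (truncation n) (\<Phi> (\<lambda>l. l * h l) x)" for n
    by (simp add: calculus_mult [OF bounded_borel_truncated_id h, symmetric]
        E_calculus [OF lh truncation_borel] truncated_id_def mult.assoc)
  then have lim: "(\<lambda>n. \<Phi> (truncated_id n) (\<Phi> h x)) \<longlonglongrightarrow> \<Phi> (\<lambda>l. l * h l) x"
    using E_truncation_LIMSEQ by simp
  then show "\<Phi> h x \<in> D"
    unfolding domain_eq convergent_def by blast
  then show "A (\<Phi> h x) = \<Phi> (\<lambda>l. l * h l) x"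
    using LIMSEQ_unique [OF operator_LIMSEQ lim] by blast
qed

lemma adjoint_op_unique:
  assumes g: "bounded_clinear g" and h: "bounded_clinear h" and gh: "\<And>x. x \<in> D \<Longrightarrow> g (A x) = h x"
  shows "g \<in> adjoint_domain D A" and "adjoint_op D A g = h"
proof -
  show "g \<in> adjoint_domain D A"
    using assms by (auto simp: adjoint_domain_def)
  show "adjoint_op D A g = h"
    unfolding adjoint_op_def
  proof (rule the_equality)
    fix h' assume h': "bounded_clinear h' \<and> (\<forall>x\<in>D. g (A x) = h' x)"
    have "closed {x. h' x = h x}"
      using h h' by (intro closed_Collect_eq linear_continuous_on bounded_clinear_imp_bounded_linear) auto
    moreover have "D \<subseteq> {x. h' x = h x}"
      using gh h' by auto
    ultimately have "closure D \<subseteq> {x. h' x = h x}"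
      by (rule closure_minimal [rotated])
    then show "h' = h"
      using dense by auto
  qed (use h gh in auto)
qed

lemma adjoint_opD:
  assumes "g \<in> adjoint_domain D A"
  shows "bounded_clinear g" "x \<in> D \<Longrightarrow> adjoint_op D A g x = g (A x)"
proof -
  obtain h where h: "bounded_clinear g" "bounded_clinear h" "\<And>x. x \<in> D \<Longrightarrow> g (A x) = h x"
    using assms by (auto simp: adjoint_domain_def)
  then show "bounded_clinear g" "x \<in> D \<Longrightarrow> adjoint_op D A g x = g (A x)"
    using adjoint_op_unique(2) [OF h] by auto
qed

lemma exp_weight_truncation: "exp_weight (indicator (truncation n)) z"
proof (rule exp_weight_bounded_support)
  show "indicator (truncation n) \<in> borel_measurable borel"
    by measurable
  show "cmod (indicator (truncation n) l) \<le> 1" for l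
    by (simp add: indicator_def)
  show "indicator (truncation n) l = 0" if "cmod l > real n" for l
    using that by (simp add: indicator_def truncation_def)
qed

text \<open>On the range of \<open>E (truncation n)\<close> the operator acts boundedly, and the product rule shows
  that \<open>e\<^bsup>-tA\<^esup> E (truncation n) (y t)\<close> has weak derivative 0, so that it is constant.
  The factor \<open>y\<close> is only continuous in norm and differentiable in the weak sense; the product rule
  still holds because the other factor is differentiable in operator norm.\<close>

lemma weak_solution_truncation:
  assumes y: "weak_solution D A y" and t: "0 \<le> t"
  shows "E (truncation n) (y t) =
    \<Phi> (\<lambda>l. indicator (truncation n) l * exp (complex_of_real t * l)) (y 0)"
proof -
  let ?w = "indicator (truncation n) :: complex \<Rightarrow> complex"
  define G where "G z = \<Phi> (\<lambda>l. ?w l * exp (z * l))" for z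
  define L where "L z = \<Phi> (\<lambda>l. l * ?w l * exp (z * l))" for z
  have bbG: "bounded_borel (\<lambda>l. ?w l * exp (z * l))" for z
    by (rule exp_weight_bounded_borel [OF exp_weight_truncation])
  have bbL: "bounded_borel (\<lambda>l. l * ?w l * exp (z * l))" for z
    by (rule exp_weight_bounded_borel [OF exp_weight_mult_id [OF exp_weight_truncation]])
  have G: "bounded_clinear (G z)" and L: "bounded_clinear (L z)" for z
    unfolding G_def L_def by (intro bounded_clinear_calculus bbG bbL)+
  have GA: "G z (A x) = L z x" if "x \<in> D" for z x
  proof -
    have "G z (A x) = \<Phi> (\<lambda>l. (?w l * exp (z * l)) * ?w l) (A x)"
      unfolding G_def by (rule arg_cong [of _ _ "\<lambda>h. \<Phi> h (A x)"]) (auto simp: indicator_def)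
    also have "\<dots> = \<Phi> (\<lambda>l. ?w l * exp (z * l)) (E (truncation n) (A x))"
      by (simp add: calculus_mult [OF bbG] bounded_borel_indicator calculus_indicator truncation_borel)
    also have "\<dots> = \<Phi> (\<lambda>l. (?w l * exp (z * l)) * truncated_id n l) x"
      by (simp add: E_truncation_operator [OF that] calculus_mult [OF bbG bounded_borel_truncated_id])
    also have "\<dots> = L z x"
      unfolding L_def by (rule arg_cong [of _ _ "\<lambda>h. \<Phi> h x"]) (auto simp: indicator_def truncated_id_def)
    finally show ?thesis .
  qed
  have G_G: "G u (G v x) = G (u + v) x" for u v x
    unfolding G_def calculus_mult [OF bbG bbG, symmetric]
    by (rule arg_cong [of _ _ "\<lambda>h. \<Phi> h x"]) (auto simp: indicator_def exp_add distrib_right)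
  have G0: "G 0 x = E (truncation n) x" for x
    by (simp add: G_def calculus_indicator truncation_borel)
  have "G (- complex_of_real t) (y t) = G 0 (y 0)"
  proof (rule eq_if_functionals_eq)
    fix g :: "'a \<Rightarrow> complex" assume g: "bounded_clinear g"
    interpret g: bounded_linear g by (rule bounded_clinear_imp_bounded_linear [OF g])
    have deriv: "((\<lambda>s. g (G (- complex_of_real s) (y s))) has_vector_derivative 0) (at s within {0..})"
      if s: "s \<in> {0..}" for s
    proof -
      let ?F = "at s within {0..}" and ?z = "- complex_of_real s"
      interpret Gs: bounded_linear "G ?z" by (rule bounded_clinear_imp_bounded_linear [OF G])
      have contd: "continuous_on {0..} y"
        and weak: "\<And>g s. g \<in> adjoint_domain D A \<Longrightarrow> s \<ge> 0 \<Longrightarrow>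
          ((\<lambda>s. g (y s)) has_vector_derivative adjoint_op D A g (y s)) (at s within {0..})"
        using y by (auto simp: weak_solution_def)
      have y_lim: "(y \<longlongrightarrow> y s) ?F"
        using contd s by (simp add: continuous_on_def)
      have adj: "(\<lambda>x. g (G ?z x)) \<in> adjoint_domain D A"
        "adjoint_op D A (\<lambda>x. g (G ?z x)) = (\<lambda>x. g (L ?z x))"
        by (rule adjoint_op_unique; use g G L GA in \<open>auto intro: bounded_clinear_compose\<close>)+
      \<comment> \<open>derivative in the factor \<open>y\<close> alone; the other factor contributes the same with opposite
        sign\<close>
      have slope2: "((\<lambda>r. inverse (r - s) *\<^sub>R (g (G ?z (y r)) - g (G ?z (y s)))) \<longlongrightarrow> g (L ?z (y s))) ?F"
        using weak [OF adj(1)] s by (simp add: has_vector_derivative_iff_slope adj(2))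
      define Q where "Q r = inverse (r - s) *\<^sub>R (G (- complex_of_real r) (y r) - G ?z (y r))" for r
      have "((\<lambda>r. Q r + L ?z (y r)) \<longlongrightarrow> 0) ?F"
      proof -
        obtain K where "\<forall>\<^sub>F z in at ?z. \<forall>x.
            norm (inverse (z - ?z) *\<^sub>C (G z x - G ?z x) - L ?z x) \<le> K * cmod (z - ?z) * norm x"
          using calculus_exp_difference_quotient_le [OF exp_weight_truncation [of n ?z]]
          unfolding G_def L_def by blast
        then have "\<forall>\<^sub>F r in ?F. \<forall>x.
            norm (inverse (- complex_of_real r - ?z) *\<^sub>C (G (- complex_of_real r) x - G ?z x) - L ?z x)
            \<le> K * cmod (- complex_of_real r - ?z) * norm x"
          using filterlim_of_real_at [of "-1" s "{0..}"]
          by (auto simp: filterlim_iff)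
        then have "\<forall>\<^sub>F r in ?F. norm (Q r + L ?z (y r)) \<le> K * \<bar>r - s\<bar> * norm (y r)"
        proof (rule eventually_mono)
          fix r assume *: "\<forall>x.
            norm (inverse (- complex_of_real r - ?z) *\<^sub>C (G (- complex_of_real r) x - G ?z x) - L ?z x)
            \<le> K * cmod (- complex_of_real r - ?z) * norm x"
          have diff: "- complex_of_real r - ?z = complex_of_real (- (r - s))"
            by simp
          have "inverse (- complex_of_real r - ?z) *\<^sub>C (G (- complex_of_real r) (y r) - G ?z (y r)) = - Q r"
            by (simp only: diff of_real_inverse [symmetric] scaleC_of_real inverse_minus_eq
                scaleR_minus_left Q_def)
          then have "norm (- Q r - L ?z (y r)) \<le> K * \<bar>r - s\<bar> * norm (y r)"
            using * [rule_format, of "y r"] unfolding diff norm_of_real by (simp add: abs_minus_commute)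
          moreover have "- Q r - L ?z (y r) = - (Q r + L ?z (y r))" by simp
          ultimately show "norm (Q r + L ?z (y r)) \<le> K * \<bar>r - s\<bar> * norm (y r)"
            by (metis norm_minus_cancel)
        qed
        moreover have "((\<lambda>r. K * \<bar>r - s\<bar> * norm (y r)) \<longlongrightarrow> 0) ?F"
          using y_lim by (auto intro!: tendsto_eq_intros)
        ultimately show ?thesis
          by (rule Lim_null_comparison)
      qed
      moreover have "((\<lambda>r. L ?z (y r)) \<longlongrightarrow> L ?z (y s)) ?F"
        by (rule bounded_linear.tendsto [OF bounded_clinear_imp_bounded_linear [OF L] y_lim])
      ultimately have "((\<lambda>r. (Q r + L ?z (y r)) - L ?z (y r)) \<longlongrightarrow> 0 - L ?z (y s)) ?F"
        by (rule tendsto_diff)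
      then have "((\<lambda>r. g (Q r)) \<longlongrightarrow> g (- L ?z (y s))) ?F"
        by (intro g.tendsto) simp
      from tendsto_add [OF this slope2] have
        "((\<lambda>r. inverse (r - s) *\<^sub>R (g (G (- complex_of_real r) (y r)) - g (G ?z (y s)))) \<longlongrightarrow> 0) ?F"
        by (simp add: Q_def g.scaleR g.diff linear_neg [OF g.linear] scaleR_add_right [symmetric])
      then show ?thesis
        by (simp add: has_vector_derivative_iff_slope)
    qed
    obtain c where "\<And>s. s \<in> {0..} \<Longrightarrow> g (G (- complex_of_real s) (y s)) = c"
      using has_vector_derivative_zero_constant [OF convex_real_interval(1) deriv] by blast
    from this [of t] this [of 0] show "g (G (- complex_of_real t) (y t)) = g (G 0 (y 0))"
      using t by simp
  qed
  then have "G (complex_of_real t) (G (- complex_of_real t) (y t)) = G (complex_of_real t) (G 0 (y 0))"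
    by simp
  then have "G 0 (y t) = G (complex_of_real t) (y 0)"
    by (simp add: G_G)
  then show ?thesis
    unfolding G0 by (simp add: G_def)
qed

end

section \<open>Spectrum essentially in a sector implies entire solutions\<close>

text \<open>In the sector \<open>\<bar>\<lambda>\<bar> \<le> (1 + 1/b) Re \<lambda>\<close>, so a decaying exponential \<open>e\<^bsup>-t\<lambda>\<^esup>\<close> with large \<open>t\<close>
  compensates a growth of order \<open>e\<^bsup>r\<bar>\<lambda>\<bar>\<^esup>\<close>.\<close>

lemma sector_growth_bound:
  assumes b: "0 < b" and R: "0 \<le> R" "\<And>l. l \<in> S - sector b \<Longrightarrow> cmod l \<le> R"
    and r: "0 \<le> r" "(1 + 1 / b) * r \<le> t" and l: "l \<in> S"
  shows "r * cmod l - t * Re l \<le> (r + t) * R"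
proof -
  have "0 \<le> (1 + 1 / b) * r" using b r(1) by simp
  with r have t: "0 \<le> t" by linarith
  show ?thesis
  proof (cases "l \<in> sector b")
    case True
    then have Re: "b * \<bar>Im l\<bar> \<le> Re l" by (simp add: sector_def)
    have Re0: "0 \<le> Re l" using Re b by (meson abs_ge_zero mult_nonneg_nonneg less_imp_le order_trans)
    have "\<bar>Im l\<bar> \<le> Re l / b" using Re b by (simp add: field_simps)
    then have "cmod l \<le> (1 + 1 / b) * Re l"
      using cmod_le [of l] Re0 by (simp add: algebra_simps)
    then have "r * cmod l \<le> r * ((1 + 1 / b) * Re l)"
      using r by (intro mult_left_mono)
    also have "\<dots> = ((1 + 1 / b) * r) * Re l" by simp
    also have "\<dots> \<le> t * Re l"
      using r Re0 by (intro mult_right_mono)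
    finally have "r * cmod l - t * Re l \<le> 0" by simp
    also have "0 \<le> (r + t) * R" using r t R by simp
    finally show ?thesis .
  next
    case False
    have "r * cmod l - t * Re l \<le> r * cmod l + t * cmod l"
    proof -
      have "t * (- Re l) \<le> t * cmod l"
        using abs_Re_le_cmod [of l] t by (intro mult_left_mono) auto
      then show ?thesis by simp
    qed
    also have "\<dots> = (r + t) * cmod l" by (simp add: distrib_right)
    also have "\<dots> \<le> (r + t) * R"
      using R(2) [of l] l False r t by (intro mult_left_mono) auto
    finally show ?thesis .
  qed
qed

context scalar_spectral_operator
begin

text \<open>On each disc the continuation is \<open>z \<mapsto> e\<^bsup>(z-t)A\<^esup> y(t)\<close> for a fixed large \<open>t\<close>: on the spectrum
  \<open>e\<^bsup>(z-t)\<lambda>\<^esup>\<close> is bounded, although neither \<open>e\<^bsup>zA\<^esup>\<close> nor \<open>e\<^bsup>-tA\<^esup>\<close> need be bounded operators.\<close>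

theorem weak_solution_entire:
  assumes b: "0 < b" and bdd: "bounded (spectrum D A - sector b)" and y: "weak_solution D A y"
  shows "entire_vector_function y"
proof -
  let ?\<sigma> = "spectral_support E"
  obtain R where R: "0 \<le> R" "\<And>l. l \<in> ?\<sigma> - sector b \<Longrightarrow> cmod l \<le> R"
    using bdd unfolding support_eq_spectrum bounded_pos by (meson less_imp_le)
  define c where "c = 1 + 1 / b"
  have c: "c > 0" using b by (simp add: c_def add_pos_pos)
  define w where "w t l = indicator ?\<sigma> l * exp (- complex_of_real t * l)" for t l
  have weight: "exp_weight (w t) z" if t: "c * (cmod z + 1) \<le> t" for t z
  proof (rule exp_weightI)
    have [measurable]: "?\<sigma> \<in> sets borel"
      by (rule borel_closed [OF closed_spectral_support])
    show "w t \<in> borel_measurable borel"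
      unfolding w_def [abs_def] by measurable
    fix l
    show "cmod (w t l) * exp (Re (z * l) + 1 * cmod l) \<le> exp ((cmod z + 1 + t) * R)"
    proof (cases "l \<in> ?\<sigma>")
      case True
      have "cmod (w t l) * exp (Re (z * l) + 1 * cmod l) = exp (Re (z * l) + cmod l - t * Re l)"
        using True by (simp add: w_def exp_add [symmetric])
      also have "\<dots> \<le> exp ((cmod z + 1) * cmod l - t * Re l)"
        using complex_Re_le_cmod [of "z * l"] by (simp add: norm_mult algebra_simps)
      also have "\<dots> \<le> exp ((cmod z + 1 + t) * R)"
        unfolding exp_le_cancel_iff
        by (rule sector_growth_bound [OF b R]) (use t True c_def in auto)
      finally show ?thesis .
    qed (simp add: w_def)
  qed simp
  have trunc: "E (truncation n) (\<Phi> (\<lambda>l. w t l * exp (z * l)) (y t)) =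
      \<Phi> (\<lambda>l. indicator (truncation n) l * exp (z * l)) (y 0)"
    if t: "c * (cmod z + 1) \<le> t" for t z n
  proof -
    let ?i = "indicator (truncation n) :: complex \<Rightarrow> complex"
    have t0: "0 \<le> t" using t c by (meson mult_nonneg_nonneg less_imp_le order_trans add_nonneg_nonneg norm_ge_zero zero_le_one)
    have bb: "bounded_borel (\<lambda>l. ?i l * exp (z * l))" for z
      by (rule exp_weight_bounded_borel [OF exp_weight_truncation])
    have "E (truncation n) (\<Phi> (\<lambda>l. w t l * exp (z * l)) (y t)) =
        \<Phi> (\<lambda>l. ?i l * (w t l * exp (z * l))) (y t)"
      by (rule E_calculus [OF exp_weight_bounded_borel [OF weight [OF t]] truncation_borel])
    also have "\<dots> = \<Phi> (\<lambda>l. (?i l * exp ((z - complex_of_real t) * l)) * ?i l) (y t)"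
      by (rule arg_cong [of _ _ "\<lambda>h. \<Phi> h (y t)"])
        (auto simp: w_def indicator_def truncation_def exp_add [symmetric] algebra_simps)
    also have "\<dots> = \<Phi> (\<lambda>l. ?i l * exp ((z - complex_of_real t) * l)) (E (truncation n) (y t))"
      by (simp add: calculus_mult [OF bb] bounded_borel_indicator calculus_indicator truncation_borel)
    also have "\<dots> = \<Phi> (\<lambda>l. (?i l * exp ((z - complex_of_real t) * l)) *
        (?i l * exp (complex_of_real t * l))) (y 0)"
      by (simp only: weak_solution_truncation [OF y t0] calculus_mult [OF bb bb])
    also have "\<dots> = \<Phi> (\<lambda>l. ?i l * exp (z * l)) (y 0)"
      by (rule arg_cong [of _ _ "\<lambda>h. \<Phi> h (y 0)"])
        (auto simp: indicator_def exp_add [symmetric] algebra_simps)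
    finally show ?thesis .
  qed
  define \<tau> where "\<tau> z = c * (cmod z + 1)" for z
  define F where "F z = \<Phi> (\<lambda>l. w (\<tau> z) l * exp (z * l)) (y (\<tau> z))" for z
  \<comment> \<open>After truncation both sides are \<open>e\<^bsup>zA\<^esup> y(0)\<close>, so the choice of \<open>t\<close> does not matter.\<close>
  have F_eq: "F z = \<Phi> (\<lambda>l. w t l * exp (z * l)) (y t)" if "c * (cmod z + 1) \<le> t" for z t
  proof (rule eq_if_truncations_eq)
    have "c * (cmod z + 1) \<le> \<tau> z" by (simp add: \<tau>_def)
    then show "E (truncation n) (F z) = E (truncation n) (\<Phi> (\<lambda>l. w t l * exp (z * l)) (y t))" for n
      by (simp only: F_def trunc that)
  qed
  have "entire F"
    unfolding entire_def
  proof
    fix z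
    \<comment> \<open>one time that serves the whole unit disc around \<open>z\<close>\<close>
    define T where "T = c * (cmod z + 2)"
    have zT: "c * (cmod v + 1) \<le> T" if "dist v z < 1" for v
    proof -
      have "cmod v \<le> cmod z + 1"
        using that norm_triangle_ineq2 [of v z] by (simp add: dist_norm)
      then show ?thesis using c by (simp add: T_def)
    qed
    have "\<forall>\<^sub>F v in at z. dist v z < 1"
      by (auto simp: eventually_at intro!: exI [of _ 1])
    then have "\<forall>\<^sub>F v in at z. inverse (v - z) *\<^sub>C
        (\<Phi> (\<lambda>l. w T l * exp (v * l)) (y T) - \<Phi> (\<lambda>l. w T l * exp (z * l)) (y T)) =
        inverse (v - z) *\<^sub>C (F v - F z)"
      by eventually_elim (simp add: F_eq [OF zT])
    moreover have "((\<lambda>v. inverse (v - z) *\<^sub>C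
        (\<Phi> (\<lambda>l. w T l * exp (v * l)) (y T) - \<Phi> (\<lambda>l. w T l * exp (z * l)) (y T)))
        \<longlongrightarrow> \<Phi> (\<lambda>l. l * w T l * exp (z * l)) (y T)) (at z)"
      by (rule calculus_exp_has_derivative [OF weight [OF zT]]) simp
    ultimately show "\<exists>L. ((\<lambda>v. inverse (v - z) *\<^sub>C (F v - F z)) \<longlongrightarrow> L) (at z)"
      by (intro exI) (rule Lim_transform_eventually)
  qed
  moreover have "F (complex_of_real t) = y t" if t: "0 \<le> t" for t
  proof (rule eq_if_truncations_eq)
    fix n
    show "E (truncation n) (F (complex_of_real t)) = E (truncation n) (y t)"
      unfolding weak_solution_truncation [OF y t] F_def by (rule trunc) (simp add: \<tau>_def)
  qed
  ultimately show ?thesis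
    unfolding entire_vector_function_def by blast
qed

end

section \<open>A weak solution that is not entire\<close>

text \<open>Outside every sector the spectrum contains arbitrarily large points, which can be chosen so
  sparse that the unit discs around them are disjoint.\<close>

lemma sparse_sequence_outside_sectors:
  assumes "\<And>b. 0 < b \<Longrightarrow> \<not> bounded (S - sector b)"
  shows "\<exists>p :: nat \<Rightarrow> complex. \<forall>k. (p k \<in> S \<and> Re (p k) < inverse (real (Suc k)) * \<bar>Im (p k)\<bar> \<and>
    2 * real k \<le> cmod (p k)) \<and> cmod (p k) + 2 \<le> cmod (p (Suc k))"
proof (rule dependent_nat_choice)
  have far: "\<exists>l\<in>S. Re l < inverse (real (Suc k)) * \<bar>Im l\<bar> \<and> B \<le> cmod l" for k B
  proof -
    have "\<not> bounded (S - sector (inverse (real (Suc k))))"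
      by (rule assms) simp
    then obtain l where "l \<in> S - sector (inverse (real (Suc k)))" "\<not> cmod l \<le> B"
      by (auto simp: bounded_iff)
    then show ?thesis
      by (intro bexI [of _ l]) (auto simp: sector_def)
  qed
  show "\<exists>l. l \<in> S \<and> Re l < inverse (real (Suc 0)) * \<bar>Im l\<bar> \<and> 2 * real 0 \<le> cmod l"
    using far [of 0 0] by auto
  fix l k
  show "\<exists>l'. (l' \<in> S \<and> Re l' < inverse (real (Suc (Suc k))) * \<bar>Im l'\<bar> \<and> 2 * real (Suc k) \<le> cmod l') \<and>
      cmod l + 2 \<le> cmod l'"
    using far [of "Suc k" "max (cmod l + 2) (2 * real (Suc k))"] by auto
qed

lemma disjoint_unit_discs:
  fixes p :: "nat \<Rightarrow> complex"
  assumes "\<And>k. cmod (p k) + 2 \<le> cmod (p (Suc k))"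
  shows "disjoint_family (\<lambda>k. ball (p k) 1)"
proof -
  have mono: "cmod (p k) \<le> cmod (p m)" if "k \<le> m" for k m
  proof (rule lift_Suc_mono_le [OF _ that])
    show "cmod (p i) \<le> cmod (p (Suc i))" for i
      using assms [of i] by simp
  qed
  have "ball (p k) 1 \<inter> ball (p m) 1 = {}" if "k < m" for k m
  proof -
    have "cmod (p k) + 2 \<le> cmod (p m)"
      using mono [of "Suc k" m] that assms [of k] by simp
    then have "dist (p k) (p m) \<ge> 1 + 1"
      using norm_triangle_ineq2 [of "p m" "p k"] by (simp add: dist_norm norm_minus_commute)
    then show ?thesis by (rule disjoint_ballI)
  qed
  then show ?thesis
    unfolding disjoint_family_on_def by (metis (full_types) Int_commute nat_neq_iff)
qed

text \<open>Multiplying by one of three complex times turns the growth of \<open>\<bar>\<lambda>\<bar>\<close> into growth of a real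
  part when \<open>\<lambda>\<close> is far from the positive axis.\<close>

lemma exists_time_growth:
  assumes "Re l \<le> \<bar>Im l\<bar>"
  shows "\<exists>z\<in>{4 * \<i>, - 4 * \<i>, - 4}. 2 * cmod l \<le> Re (z * l)"
proof -
  have "cmod l \<le> \<bar>Re l\<bar> + \<bar>Im l\<bar>" by (rule cmod_le)
  then have "2 * cmod l \<le> - 4 * Im l \<or> 2 * cmod l \<le> 4 * Im l \<or> 2 * cmod l \<le> - 4 * Re l"
    using assms by linarith
  then show ?thesis by auto
qed

lemma exp_weight_disc:
  "exp_weight (\<lambda>l. indicator (ball p 1) l * exp (- complex_of_real (cmod l))) z"
proof (rule exp_weight_bounded_support)
  have [measurable]: "ball p 1 \<in> sets borel"
    by simp
  show "(\<lambda>l. indicator (ball p 1) l * exp (- complex_of_real (cmod l))) \<in> borel_measurable borel"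
    by measurable
  show "cmod (indicator (ball p 1) l * exp (- complex_of_real (cmod l))) \<le> 1" for l
    by (simp add: indicator_def norm_mult)
  show "indicator (ball p 1) l * exp (- complex_of_real (cmod l)) = 0" if "cmod l > cmod p + 1" for l
    using that norm_triangle_ineq2 [of l p]
    by (auto simp: indicator_def dist_norm norm_minus_commute)
qed

context spectral_measure_on_complex
begin

text \<open>Sum unit vectors from the ranges of the \<open>E (\<Delta> k)\<close> with geometric coefficients: by disjointness
  \<open>E (\<Delta> k)\<close> picks out the \<open>k\<close>-th term.\<close>

lemma exists_vector_charging_all:
  assumes borel: "\<And>k. \<Delta> k \<in> sets borel" and disj: "disjoint_family \<Delta>"
    and nz: "\<And>k. \<exists>x. E (\<Delta> k) x \<noteq> 0"
  shows "\<exists>f. \<forall>k::nat. norm (E (\<Delta> k) f) = (1 / 2) ^ k"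
proof -
  have "\<exists>e. norm e = 1 \<and> E (\<Delta> k) e = e" for k
  proof -
    interpret bounded_linear "E (\<Delta> k)" by (rule bounded_linear_E [OF borel])
    obtain x where x: "E (\<Delta> k) x \<noteq> 0" using nz by blast
    have "E (\<Delta> k) (inverse (norm (E (\<Delta> k) x)) *\<^sub>R E (\<Delta> k) x) = inverse (norm (E (\<Delta> k) x)) *\<^sub>R E (\<Delta> k) x"
      by (simp add: scaleR E_Int [OF borel borel])
    then show ?thesis
      using x by (intro exI [of _ "inverse (norm (E (\<Delta> k) x)) *\<^sub>R E (\<Delta> k) x"]) simp
  qed
  then obtain e where e: "\<And>k. norm (e k) = 1" "\<And>k. E (\<Delta> k) (e k) = e k" by metis
  let ?a = "\<lambda>k. (1 / 2) ^ k *\<^sub>R e k"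
  have "summable (\<lambda>k. norm (?a k))"
    by (simp add: e summable_geometric)
  then have summable_a: "summable ?a"
    by (rule summable_norm_cancel)
  have "norm (E (\<Delta> j) (suminf ?a)) = (1 / 2) ^ j" for j
  proof -
    interpret bounded_linear "E (\<Delta> j)" by (rule bounded_linear_E [OF borel])
    have charge: "E (\<Delta> j) (?a k) = (if k = j then ?a k else 0)" for k
    proof (cases "k = j")
      case False
      then have "\<Delta> j \<inter> \<Delta> k = {}" using disj by (auto simp: disjoint_family_on_def)
      then have "E (\<Delta> j) (E (\<Delta> k) (e k)) = 0" by (simp add: E_Int [OF borel borel])
      then show ?thesis using False by (simp add: e scaleR)
    qed (simp add: e scaleR)
    have "(\<lambda>k. E (\<Delta> j) (?a k)) sums E (\<Delta> j) (suminf ?a)"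
      by (rule bounded_linear.sums [OF bounded_linear_E [OF borel] summable_sums [OF summable_a]])
    then have "E (\<Delta> j) (suminf ?a) = ?a j"
      unfolding charge using sums_unique2 [OF _ sums_single [of j ?a]] by blast
    then show ?thesis by (simp add: e)
  qed
  then show ?thesis by blast
qed

text \<open>On the disc the exponential can be inverted by a bounded function, whose size is governed by its
  value at the centre \<open>p\<close>: over the disc \<open>\<bar>\<lambda>\<bar>\<close> varies by at most 1 and \<open>Re (z \<lambda>)\<close> by at most \<open>\<bar>z\<bar>\<close>.\<close>

lemma norm_E_disc_le_calculus:
  "norm (E (ball p 1) f) \<le> 4 * spectral_bound * exp (cmod p + 1 - Re (z * p) + cmod z) *
    norm (\<Phi> (\<lambda>l. indicator (ball p 1) l * exp (- complex_of_real (cmod l)) * exp (z * l)) f)"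
proof -
  let ?i = "indicator (ball p 1) :: complex \<Rightarrow> complex"
  let ?v = "\<lambda>l. ?i l * exp (complex_of_real (cmod l)) * exp (- z * l)"
  have near: "cmod l \<le> cmod p + 1" if "l \<in> ball p 1" for l
    using that norm_triangle_ineq2 [of l p] by (simp add: dist_norm norm_minus_commute)
  have v: "bounded_borel ?v" and v_le: "\<And>l. cmod (?v l) \<le> exp (cmod p + 1 - Re (z * p) + cmod z)"
  proof -
    show le: "cmod (?v l) \<le> exp (cmod p + 1 - Re (z * p) + cmod z)" for l
    proof (cases "l \<in> ball p 1")
      case True
      have "Re (z * p) - Re (z * l) \<le> cmod (z * (p - l))"
        using complex_Re_le_cmod [of "z * (p - l)"] by (simp add: right_diff_distrib)
      also have "\<dots> \<le> cmod z * 1"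
        unfolding norm_mult using True by (intro mult_left_mono) (auto simp: dist_norm)
      finally have "cmod l - Re (z * l) \<le> cmod p + 1 - Re (z * p) + cmod z"
        using near [OF True] by simp
      then show ?thesis
        using True by (simp add: norm_mult exp_add [symmetric])
    qed simp
    have [measurable]: "ball p 1 \<in> sets borel"
      by simp
    show "bounded_borel ?v"
      by (rule bounded_borelI [OF _ le]) measurable
  qed
  have w: "bounded_borel (\<lambda>l. ?i l * exp (- complex_of_real (cmod l)) * exp (z * l))"
    by (rule exp_weight_bounded_borel [OF exp_weight_disc])
  have "E (ball p 1) f = \<Phi> (\<lambda>l. ?v l * (?i l * exp (- complex_of_real (cmod l)) * exp (z * l))) f"
    unfolding calculus_indicator [symmetric, OF borel_open [OF open_ball]]
    by (rule arg_cong [of _ _ "\<lambda>h. \<Phi> h f"]) (auto simp: indicator_def exp_minus field_simps)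
  also have "\<dots> = \<Phi> ?v (\<Phi> (\<lambda>l. ?i l * exp (- complex_of_real (cmod l)) * exp (z * l)) f)"
    by (rule calculus_mult [OF v w])
  finally have eq: "E (ball p 1) f =
    \<Phi> ?v (\<Phi> (\<lambda>l. ?i l * exp (- complex_of_real (cmod l)) * exp (z * l)) f)" .
  show ?thesis
    unfolding eq by (rule norm_calculus_le [OF v v_le])
qed

end

context scalar_spectral_operator
begin

text \<open>Such functions are even norm differentiable, with derivative \<open>A y\<close>.\<close>

lemma weak_solution_calculus_exp:
  assumes w: "\<And>t. 0 \<le> t \<Longrightarrow> exp_weight w (complex_of_real t)"
  shows "weak_solution D A (\<lambda>t. \<Phi> (\<lambda>l. w l * exp (complex_of_real t * l)) x)"
  unfolding weak_solution_def
proof (intro conjI ballI allI impI)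
  let ?y = "\<lambda>t. \<Phi> (\<lambda>l. w l * exp (complex_of_real t * l)) x"
  let ?y' = "\<lambda>t. \<Phi> (\<lambda>l. l * w l * exp (complex_of_real t * l)) x"
  have deriv: "(?y has_vector_derivative ?y' t) (at t within {0..})" if "0 \<le> t" for t
    by (rule calculus_exp_has_vector_derivative [OF w [OF that]])
  then show "continuous_on {0..} ?y"
    by (intro continuous_on_vector_derivative) auto
  fix g t assume g: "g \<in> adjoint_domain D A" and t: "0 \<le> (t::real)"
  have bb: "bounded_borel (\<lambda>l. w l * exp (complex_of_real t * l))"
    by (rule exp_weight_bounded_borel [OF w [OF t]])
  have bb': "bounded_borel (\<lambda>l. l * (w l * exp (complex_of_real t * l)))"
    using exp_weight_bounded_borel [OF exp_weight_mult_id [OF w [OF t]]] by (simp add: mult.assoc)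
  have "adjoint_op D A g (?y t) = g (?y' t)"
    by (simp add: adjoint_opD(2) [OF g calculus_in_domain(1) [OF bb bb']]
        calculus_in_domain(2) [OF bb bb'] mult.assoc)
  then show "((\<lambda>s. g (?y s)) has_vector_derivative adjoint_op D A g (?y t)) (at t within {0..})"
    using bounded_linear.has_vector_derivative
      [OF bounded_clinear_imp_bounded_linear [OF adjoint_opD(1) [OF g]] deriv [OF t]] by simp
qed

text \<open>The weight \<open>e\<^bsup>-\<bar>\<lambda>\<bar>\<^esup>\<close> is strong enough for \<open>y\<close> to exist at all positive times, where \<open>Re \<lambda>\<close> counts
  only with a factor \<open>1 / (k + 1)\<close>, but too weak for the times \<open>\<plusminus>4\<i>\<close> and \<open>-4\<close>: an entire continuation
  would force \<open>2\<^bsup>-k\<^esup> \<le> C e\<^bsup>-2k\<^esup>\<close> for all \<open>k\<close>.\<close>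

theorem exists_weak_solution_not_entire:
  assumes unb: "\<And>b. 0 < b \<Longrightarrow> \<not> bounded (spectrum D A - sector b)"
  shows "\<exists>y. weak_solution D A y \<and> \<not> entire_vector_function y"
proof -
  let ?M = "spectral_bound"
  obtain p :: "nat \<Rightarrow> complex" where p: "\<And>k. p k \<in> spectrum D A"
    and Re_p: "\<And>k. Re (p k) < inverse (real (Suc k)) * \<bar>Im (p k)\<bar>"
    and p_ge: "\<And>k. 2 * real k \<le> cmod (p k)"
    and p_step: "\<And>k. cmod (p k) + 2 \<le> cmod (p (Suc k))"
    using sparse_sequence_outside_sectors [OF unb] by metis
  have p_mono: "cmod (p k) \<le> cmod (p m)" if "k \<le> m" for k m
  proof (rule lift_Suc_mono_le [OF _ that])
    show "cmod (p i) \<le> cmod (p (Suc i))" for i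
      using p_step [of i] by simp
  qed
  define \<Delta> where "\<Delta> k = ball (p k) 1" for k
  have disj: "disjoint_family \<Delta>"
    unfolding \<Delta>_def [abs_def] by (rule disjoint_unit_discs) (rule p_step)
  have "\<exists>x. E (\<Delta> k) x \<noteq> 0" for k
    using p [of k] unfolding support_eq_spectrum [symmetric] spectral_support_def \<Delta>_def by auto
  then obtain f where f: "\<And>k. norm (E (\<Delta> k) f) = (1 / 2) ^ k"
    using exists_vector_charging_all [of \<Delta>] disj by (auto simp: \<Delta>_def)
  define w where "w l = indicator (\<Union>k. \<Delta> k) l * exp (- complex_of_real (cmod l))" for l
  have weight: "exp_weight w (complex_of_real t)" if t: "0 \<le> t" for t
  proof -
    \<comment> \<open>From the \<open>K\<close>-th disc on, \<open>t Re \<lambda>\<close> costs at most half of the weight; the finitely many discs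
      before it are bounded.\<close>
    define K where "K = nat \<lceil>2 * t\<rceil>"
    have K: "2 * t \<le> real K" unfolding K_def by (rule real_nat_ceiling_ge)
    let ?C = "1 / 2 + t + t * (cmod (p K) + 1)"
    show ?thesis
    proof (rule exp_weightI [of _ "1 / 4" _ "exp ?C"])
      have [measurable]: "(\<Union>k. \<Delta> k) \<in> sets borel" by (simp add: \<Delta>_def)
      show "w \<in> borel_measurable borel"
        unfolding w_def [abs_def] by measurable
      fix l
      show "cmod (w l) * exp (Re (complex_of_real t * l) + 1 / 4 * cmod l) \<le> exp ?C"
      proof (cases "l \<in> (\<Union>k. \<Delta> k)")
        case True
        then obtain k where "l \<in> \<Delta> k" by blast
        then have lp: "cmod (l - p k) < 1" by (simp add: \<Delta>_def dist_norm norm_minus_commute)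
        have near: "cmod l \<le> cmod (p k) + 1" "cmod (p k) \<le> cmod l + 1" "Re l \<le> Re (p k) + 1"
          using lp norm_triangle_ineq2 [of l "p k"] norm_triangle_ineq2 [of "p k" l]
            complex_Re_le_cmod [of "l - p k"] by (simp_all add: norm_minus_commute)
        have "t * Re l - 3 / 4 * cmod l \<le> ?C"
        proof (cases "K \<le> k")
          case True
          have "Re l \<le> inverse (real (Suc k)) * \<bar>Im (p k)\<bar> + 1"
            using near(3) Re_p [of k] by linarith
          also have "\<dots> \<le> inverse (real (Suc k)) * (cmod l + 1) + 1"
            using near(2) abs_Im_le_cmod [of "p k"] by (intro add_right_mono mult_left_mono) auto
          finally have "t * Re l \<le> t * (inverse (real (Suc k)) * (cmod l + 1) + 1)"
            using t by (rule mult_left_mono)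
          also have "\<dots> = (t * inverse (real (Suc k))) * (cmod l + 1) + t"
            by (simp add: distrib_left mult.assoc)
          also have "t * inverse (real (Suc k)) \<le> 1 / 2"
            using K True by (simp add: field_simps)
          then have "(t * inverse (real (Suc k))) * (cmod l + 1) + t \<le> 1 / 2 * (cmod l + 1) + t"
            by (intro add_right_mono mult_right_mono) auto
          finally have "t * Re l \<le> 1 / 2 * (cmod l + 1) + t" .
          moreover have "0 \<le> t * (cmod (p K) + 1)" using t by simp
          moreover have "1 / 2 * (cmod l + 1) - 3 / 4 * cmod l \<le> 1 / 2"
            by (simp add: field_simps)
          ultimately show ?thesis by linarith
        next
          case False
          then have "cmod l \<le> cmod (p K) + 1" using near(1) p_mono [of k K] by simp
          then have "t * Re l \<le> t * (cmod (p K) + 1)"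
            using t complex_Re_le_cmod [of l] by (intro mult_left_mono) auto
          then show ?thesis using t norm_ge_zero [of l] by linarith
        qed
        then show ?thesis
          using True by (simp add: w_def exp_add [symmetric])
      qed (simp add: w_def)
    qed simp
  qed
  define y where "y t = \<Phi> (\<lambda>l. w l * exp (complex_of_real t * l)) f" for t
  have "weak_solution D A y"
    unfolding y_def [abs_def] by (rule weak_solution_calculus_exp [OF weight])
  moreover have "\<not> entire_vector_function y"
  proof
    assume "entire_vector_function y"
    then obtain F where F: "entire F" "\<And>t. 0 \<le> t \<Longrightarrow> F (complex_of_real t) = y t"
      by (auto simp: entire_vector_function_def)
    define H where "H k z = \<Phi> (\<lambda>l. indicator (\<Delta> k) l * exp (- complex_of_real (cmod l)) * exp (z * l)) f" for k z
    have borel: "\<Delta> k \<in> sets borel" for k by (simp add: \<Delta>_def)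
    have H_entire: "entire (H k)" for k
      unfolding H_def [abs_def] \<Delta>_def by (rule entire_calculus_exp [OF exp_weight_disc])
    have E_F: "E (\<Delta> k) (F z) = H k z" for k z
    proof (rule eq_if_functionals_eq)
      fix g :: "'a \<Rightarrow> complex" assume g: "bounded_clinear g"
      have zero: "g (E (\<Delta> k) (F v)) - g (H k v) = 0" if v: "v \<in> complex_of_real ` {0..}" for v
      proof -
        obtain t where t: "0 \<le> t" "v = complex_of_real t" using v by auto
        have "E (\<Delta> k) (F v) = \<Phi> (\<lambda>l. indicator (\<Delta> k) l * (w l * exp (complex_of_real t * l))) f"
          unfolding t(2) F(2) [OF t(1)] y_def
          by (rule E_calculus [OF exp_weight_bounded_borel [OF weight [OF t(1)]] borel])
        also have "\<dots> = H k v"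
          unfolding H_def t(2) by (rule arg_cong [of _ _ "\<lambda>h. \<Phi> h f"]) (auto simp: w_def indicator_def fun_eq_iff)
        finally show ?thesis by simp
      qed
      have "g (E (\<Delta> k) (F z)) - g (H k z) = 0"
      proof (rule analytic_continuation [of "\<lambda>z. g (E (\<Delta> k) (F z)) - g (H k z)" UNIV _ 0])
        show "(\<lambda>z. g (E (\<Delta> k) (F z)) - g (H k z)) holomorphic_on UNIV"
          by (intro holomorphic_on_diff entire_imp_holomorphic [OF H_entire g]
              entire_imp_holomorphic [OF F(1) bounded_clinear_compose [OF g bounded_clinear_E [OF borel]]])
        show "0 islimpt complex_of_real ` {0..}"
          unfolding islimpt_approachable
        proof (intro allI impI)
          fix e :: real assume "0 < e"
          then show "\<exists>x'\<in>complex_of_real ` {0..}. x' \<noteq> 0 \<and> dist x' 0 < e"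
            by (intro bexI [of _ "complex_of_real (e / 2)"]) (auto simp del: of_real_divide)
        qed
      qed (use zero in auto)
      then show "g (E (\<Delta> k) (F z)) = g (H k z)" by simp
    qed
    define N where "N = norm (F (4 * \<i>)) + norm (F (- 4 * \<i>)) + norm (F (- 4))"
    \<comment> \<open>The exponent 5 is \<open>1 + \<bar>z\<bar>\<close> for the three times \<open>z\<close> of modulus 4.\<close>
    define C where "C = 4 * ?M * exp 5 * (?M * N)"
    have C0: "0 \<le> C" using spectral_bound_nonneg by (simp add: C_def N_def)
    have "2 ^ k \<le> C" for k
    proof -
      have "Re (p k) \<le> \<bar>Im (p k)\<bar>"
      proof -
        have "inverse (real (Suc k)) * \<bar>Im (p k)\<bar> \<le> 1 * \<bar>Im (p k)\<bar>"
          by (intro mult_right_mono) (auto simp: field_simps)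
        then show ?thesis using Re_p [of k] by linarith
      qed
      then obtain z where z: "z \<in> {4 * \<i>, - 4 * \<i>, - 4}" "2 * cmod (p k) \<le> Re (z * p k)"
        using exists_time_growth by blast
      then have z4: "cmod z = 4" and N: "norm (F z) \<le> N" by (auto simp: norm_mult N_def)
      have "(1 / 2) ^ k \<le> 4 * ?M * exp (cmod (p k) + 1 - Re (z * p k) + cmod z) * norm (H k z)"
        using norm_E_disc_le_calculus [of "p k" f z] f [of k] by (simp add: H_def \<Delta>_def)
      also have "\<dots> \<le> 4 * ?M * (exp 5 * exp (- (2 * real k))) * (?M * N)"
      proof (intro mult_mono mult_left_mono)
        have "exp (cmod (p k) + 1 - Re (z * p k) + cmod z) \<le> exp (5 - 2 * real k)"
          using z(2) z4 p_ge [of k] by simp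
        also have "\<dots> = exp 5 * exp (- (2 * real k))"
          by (simp add: exp_diff exp_minus divide_inverse)
        finally show "exp (cmod (p k) + 1 - Re (z * p k) + cmod z) \<le> exp 5 * exp (- (2 * real k))" .
        have "norm (H k z) \<le> ?M * norm (F z)"
          unfolding E_F [symmetric] by (rule norm_E_le [OF borel])
        also have "\<dots> \<le> ?M * N" using N spectral_bound_nonneg by (rule mult_left_mono)
        finally show "norm (H k z) \<le> ?M * N" .
      qed (use spectral_bound_nonneg in auto)
      also have "\<dots> = C * exp (- (2 * real k))" by (simp add: C_def)
      finally have "(1 / 2) ^ k * exp (2 * real k) \<le> (C * exp (- (2 * real k))) * exp (2 * real k)"
        by (rule mult_right_mono) simp
      also have "(C * exp (- (2 * real k))) * exp (2 * real k) = C"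
        unfolding mult.assoc exp_add [symmetric] by simp
      finally have "(1 / 2) ^ k * exp (2 * real k) \<le> C" .
      moreover have "(2::real) ^ k \<le> (1 / 2) ^ k * exp (2 * real k)"
      proof -
        have "(2::real) \<le> exp 1" using exp_ge_add_one_self [of 1] by simp
        then have "(2::real) ^ (k + k) \<le> exp 1 ^ (k + k)" by (rule power_mono) simp
        moreover have "exp (1::real) ^ (k + k) = exp (2 * real k)"
        proof -
          have "2 * real k = real (k + k) * 1" by simp
          then show ?thesis by (simp only: exp_of_nat_mult)
        qed
        ultimately have "(2::real) ^ k * 2 ^ k \<le> exp (2 * real k)"
          by (simp only: power_add)
        then have "(1 / 2) ^ k * ((2::real) ^ k * 2 ^ k) \<le> (1 / 2) ^ k * exp (2 * real k)"
          by (rule mult_left_mono) simp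
        moreover have "(1 / 2) ^ k * (2::real) ^ k = 1"
          unfolding power_mult_distrib [symmetric] by simp
        ultimately show ?thesis
          by (simp only: mult.assoc [symmetric] mult_1_left)
      qed
      ultimately show ?thesis by linarith
    qed
    moreover obtain k where "C < 2 ^ k"
      using real_arch_pow [of 2 C] by auto
    ultimately show False by (meson not_le)
  qed
  ultimately show ?thesis by blast
qed

end

theorem corollary4p1:
  fixes D :: "'a::complex_banach set" and A :: "'a \<Rightarrow> 'a"
  assumes "scalar_type_spectral_operator D A"
  shows "(\<forall>y. weak_solution D A y \<longrightarrow> entire_vector_function y) \<longleftrightarrow>
    (\<exists>b>0. bounded (spectrum D A - sector b))"
proof -
  obtain E where E: "resolution_of_identity D A E"
    using assms by (auto simp: scalar_type_spectral_operator_def)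
  interpret scalar_spectral_operator E D A
  proof
    show "spectral_measure E"
      using E by (simp add: resolution_of_identity_def)
    show "closure D = UNIV"
      using assms by (simp add: scalar_type_spectral_operator_def densely_defined_def)
  qed (rule E)
  show ?thesis
  proof
    assume entire: "\<forall>y. weak_solution D A y \<longrightarrow> entire_vector_function y"
    show "\<exists>b>0. bounded (spectrum D A - sector b)"
    proof (rule ccontr)
      assume "\<not> ?thesis"
      then have "\<not> bounded (spectrum D A - sector b)" if "0 < b" for b
        using that by blast
      from exists_weak_solution_not_entire [OF this] entire show False
        by blast
    qed
  next
    assume "\<exists>b>0. bounded (spectrum D A - sector b)"
    then obtain b where b: "0 < b" "bounded (spectrum D A - sector b)"
      by blast
    show "\<forall>y. weak_solution D A y \<longrightarrow> entire_vector_function y"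
      by (intro allI impI) (rule weak_solution_entire [OF b])
  qed
qed

end
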